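(* For every $k\ge2$, $$g^{\rm comb}_k(x)=g^{\rm comb}_1(x)\cdot\big(s\,x\,\partial_x-1\big)g^{\rm comb}_{k-1}(x),$$ where for $k\ge1$, $g^{\rm comb}_k(x)=\sum_{C\in\mathcal R_{\rm dec},\,b(C)\ge k}\omega_C\,\hat a_C\,a_{d_{b(C)},b(C)-k}\,x^{\|C\|}\in A[[x]]$.
   Context: Fix a commutative $\mathbb Q$-algebra $A$, an integer $s$, and elements $a_{k,i}\in A$ ($k\ge1$, $i\ge0$). For $y$ and $n\ge0$, $\binom{y}{n}=y(y-1)\cdots(y-n+1)/n!$. Chord diagrams. A rooted chord diagram of size $n$ is a fixed-point-free involution $C$ of $\{1,\dots,2n\}$, viewed as $n$ chords (transpositions) $(x\,y)$ with $x<y$; the chord containing $1$ is the root chord; $|C|=n$. Chords $(x\,y),(x'\,y')$ cross if $x<x'<y<y'$ or $x'<x<y'<y$. $C$ is connected if the graph whose vertices are the chords, with edges joining crossing chords, is connected. For a set of $m$ chords with $2m$ distinct positive integer endpoints, $\mathrm{norm}$ of it is the chord diagram on $\{1,\dots,2m\}$ obtained by replacing each endpoint by its rank among the $2m$ endpoints. Intersection order. The chords of a rooted connected chord diagram of size $n$ are labeled $1,\dots,n$ recursively: the root chord gets the first available label; the remaining chords split into connected components (w.r.t. crossing); the components are processed in increasing order of their smallest endpoint, each regarded as a rooted connected chord diagram rooted at its chord with smallest endpoint and labeled recursively with the next block of consecutive labels. "Chord $i$" means the chord with label $i$. Terminal and base chords. Chord $i$ is terminal if it crosses no chord $j$ with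 $j>i$. If $t_0<t_1<\dots<t_m$ are the terminal labels, the base chord is $b(C)=t_0$. Insertion of chord diagrams. For $C$ of size $n$ with chords $(x_1y_1),\dots,(x_ny_n)$, root $(x_1y_1)$ ($x_1=1$), $D$ of size $m$ with chords $(x'_iy'_i)$, and $1\le k\le 2m-1$, $C\circ_kD$ is the chord diagram of size $n+m$ with chords $(1,y_1+k)$, $(x_i+k,y_i+k)$ ($2\le i\le n$), $(H(x'_i),H(y'_i))$ ($1\le i\le m$), where $H(x)=x+1$ if $x\le k$ and $H(x)=x+2n$ otherwise. Root share decomposition. For rooted connected $C$ with $|C|\ge2$, let $C_1$ be the connected component (of the chords other than the root) having the smallest endpoint among such components. There is a unique $i$ with $C=C'\circ_iC''$, where $C'=\mathrm{norm}(C\setminus C_1)$, $C''=\mathrm{norm}(C_1)$. Trees. Trees are rooted plane binary trees (every non-leaf vertex has a left and a right child) with labeled leaves. For such $T,T'$ with $T'$ having $\ell$ leaves and $1\le k\le2\ell-1$: add a virtual edge above the root of $T'$, number it $1$, and number the other $2\ell-2$ edges $2,3,\dots$ in pre-order of their lower endpoints (left subtree before right). $T\circ_kT'$ is obtained by subdividing edge $k$ of $T'$ by a new vertex $v$, making the part of $T'$ below edge $k$ the right subtree of $v$ and $T$ the left subtree of $v$; leaf labels are kept. Insertion tree. If $|C|=1$, $T(C)$ is a single vertex labeled by the label of its chord; if $|C|\ge2$ with root share decomposition $C=C'\circ_iC''$, then $T(C)=T(C')\circ_iT(C'')$, where the leaves of $T(C'),T(C'')$ carry the intersection-order labels in $C$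 of the corresponding chords. Branch-left vector. For a leaf $v$, $\nu_v$ is the number of edges in the path starting at $v$ and repeatedly moving to the parent as long as the current vertex is a right child. $\nu_i(C)$ is $\nu_v$ for the leaf $v$ of $T(C)$ labeled $i$. Decorations. A decorated chord diagram is a rooted connected chord diagram with a positive integer $d_i$ on each chord $i$; $\|C\|=\sum_id_i$; $\mathcal R_{\rm dec}$ is the set of all of them (labels, terminal chords, $T(C)$, $\nu$ ignore decorations). Weight and monomial. $\omega_C=\prod_{i=1}^{|C|}\binom{sd_i+\nu_i(C)-2}{\nu_i(C)}$. With terminal labels $t_0<\dots<t_m$, $\hat a_C=\prod_{c=1}^m a_{d_{t_c},t_c-t_{c-1}}\cdot\prod_{i\text{ non-terminal}}a_{d_i,0}$. *)

theory Defs
  imports "HOL-Computational_Algebra.Formal_Power_Series"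
begin

section \<open>Chord diagrams\<close>

type_synonym chord = "nat \<times> nat"

definition endpoints :: "chord set \<Rightarrow> nat set" where
  "endpoints S = fst ` S \<union> snd ` S"

text \<open>A chord diagram of size n: n chords (x,y), x<y, pairwise disjoint, whose
  endpoints are exactly {1..2n} (i.e. a fixed-point-free involution of {1..2n}).\<close>
definition is_chord_diagram :: "nat \<Rightarrow> chord set \<Rightarrow> bool" where
  "is_chord_diagram n C \<longleftrightarrow> finite C \<and> card C = n \<and> (\<forall>c\<in>C. fst c < snd c)
     \<and> endpoints C = {1..2*n}
     \<and> (\<forall>c\<in>C. \<forall>c'\<in>C. c \<noteq> c' \<longrightarrow> {fst c, snd c} \<inter> {fst c', snd c'} = {})"

definition crosses :: "chord \<Rightarrow> chord \<Rightarrow> bool" where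
  "crosses c c' \<longleftrightarrow> (fst c < fst c' \<and> fst c' < snd c \<and> snd c < snd c')
                   \<or> (fst c' < fst c \<and> fst c < snd c' \<and> snd c' < snd c)"

definition cross_rel :: "chord set \<Rightarrow> (chord \<times> chord) set" where
  "cross_rel S = {(c, c'). c \<in> S \<and> c' \<in> S \<and> crosses c c'}"

definition connected_chords :: "chord set \<Rightarrow> bool" where
  "connected_chords S \<longleftrightarrow> (\<forall>c\<in>S. \<forall>c'\<in>S. (c, c') \<in> (cross_rel S)\<^sup>*)"

text \<open>Rooted connected chord diagram of size n (n \<ge> 1 so that the root chord exists).\<close>
definition rooted_connected :: "nat \<Rightarrow> chord set \<Rightarrow> bool" where
  "rooted_connected n C \<longleftrightarrow> n \<ge> 1 \<and> is_chord_diagram n C \<and> connected_chords C"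

text \<open>Connected component (w.r.t. crossing) of c inside S, and all components.\<close>
definition comp :: "chord set \<Rightarrow> chord \<Rightarrow> chord set" where
  "comp S c = {c' \<in> S. (c, c') \<in> (cross_rel S)\<^sup>*}"

definition components :: "chord set \<Rightarrow> chord set set" where
  "components S = comp S ` S"

definition minpt :: "chord set \<Rightarrow> nat" where
  "minpt K = Min (endpoints K)"

text \<open>Root of a set of chords: the chord with the smallest endpoint
  (for a chord diagram this is the chord containing 1).\<close>
definition root :: "chord set \<Rightarrow> chord" where
  "root S = (SOME c. c \<in> S \<and> (\<forall>c'\<in>S. fst c \<le> fst c'))"

section \<open>Intersection order\<close>

text \<open>Recursive labelling, written with an explicit fuel argument (the recursion
  is on strictly smaller sets, so fuel = card S suffices).  Labels start at 1.\<close>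
primrec lab_fuel :: "nat \<Rightarrow> chord set \<Rightarrow> chord \<Rightarrow> nat" where
  "lab_fuel 0 S c = 1"
| "lab_fuel (Suc f) S c =
     (if c = root S then 1
      else (let R = S - {root S}; K = comp R c in
            1 + (\<Sum>K'\<in>{K' \<in> components R. minpt K' < minpt K}. card K') + lab_fuel f K c))"

definition label :: "chord set \<Rightarrow> chord \<Rightarrow> nat" where
  "label C c = lab_fuel (card C) C c"

definition terminal :: "chord set \<Rightarrow> chord \<Rightarrow> bool" where
  "terminal C c \<longleftrightarrow> \<not> (\<exists>c'\<in>C. label C c < label C c' \<and> crosses c c')"

definition term_labels :: "chord set \<Rightarrow> nat set" where
  "term_labels C = label C ` {c \<in> C. terminal C c}"

definition base :: "chord set \<Rightarrow> nat" where
  "base C = Min (term_labels C)"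

section \<open>Normalisation and insertion of chord diagrams\<close>

definition rank :: "nat set \<Rightarrow> nat \<Rightarrow> nat" where
  "rank E p = card {q \<in> E. q < p} + 1"

definition norm_chord :: "chord set \<Rightarrow> chord \<Rightarrow> chord" where
  "norm_chord S c = (rank (endpoints S) (fst c), rank (endpoints S) (snd c))"

definition norm :: "chord set \<Rightarrow> chord set" where
  "norm S = norm_chord S ` S"

text \<open>The chord of S corresponding to a chord of norm S.\<close>
definition denorm :: "chord set \<Rightarrow> chord \<Rightarrow> chord" where
  "denorm S c' = (THE c. c \<in> S \<and> norm_chord S c = c')"

definition ins_chord :: "chord set \<Rightarrow> nat \<Rightarrow> chord set \<Rightarrow> chord set" where
  "ins_chord C k D =
     (let r = root C; n = card C; H = (\<lambda>x. if x \<le> k then x + 1 else x + 2 * n) in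
      {(1, snd r + k)} \<union> (\<lambda>(x, y). (x + k, y + k)) ` (C - {r}) \<union> (\<lambda>(x, y). (H x, H y)) ` D)"

text \<open>The component (of the non-root chords) with the smallest endpoint.\<close>
definition first_comp :: "chord set \<Rightarrow> chord set" where
  "first_comp R = (SOME K. K \<in> components R \<and> (\<forall>K'\<in>components R. minpt K \<le> minpt K'))"

section \<open>Trees\<close>

datatype itree = Leaf nat | Node itree itree

fun tsize :: "itree \<Rightarrow> nat" where
  "tsize (Leaf l) = 1"
| "tsize (Node L R) = 1 + tsize L + tsize R"

text \<open>graft T k T' = T \<circ>_k T': edge k of T' (edge 1 = virtual edge above the root,
  other edges numbered by pre-order of their lower endpoints) is subdivided by a
  new vertex whose left subtree is T and right subtree the part of T' below edge k.
  Edge number k = pre-order index of its lower endpoint.\<close>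
fun graft :: "itree \<Rightarrow> nat \<Rightarrow> itree \<Rightarrow> itree" where
  "graft T k (Leaf l) = (if k = 1 then Node T (Leaf l) else Leaf l)"
| "graft T k (Node L R) =
     (if k = 1 then Node T (Node L R)
      else if k - 1 \<le> tsize L then Node (graft T (k - 1) L) R
      else Node L (graft T (k - 1 - tsize L) R))"

text \<open>Insertion tree via the root share decomposition, with explicit fuel; lab gives
  the leaf label (intersection-order label in the original diagram) of each chord.\<close>
primrec tree_fuel :: "nat \<Rightarrow> chord set \<Rightarrow> (chord \<Rightarrow> nat) \<Rightarrow> itree" where
  "tree_fuel 0 D lab = Leaf 0"
| "tree_fuel (Suc f) D lab =
     (if card D = 1 then Leaf (lab (the_elem D))
      else (let R = D - {root D}; C1 = first_comp R; S' = D - C1;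
                C' = norm S'; C'' = norm C1;
                i = (THE i. 1 \<le> i \<and> i \<le> 2 * card C'' - 1 \<and> D = ins_chord C' i C'')
            in graft (tree_fuel f C' (\<lambda>c. lab (denorm S' c))) i
                     (tree_fuel f C'' (\<lambda>c. lab (denorm C1 c)))))"

definition ins_tree :: "chord set \<Rightarrow> itree" where
  "ins_tree C = tree_fuel (card C) C (label C)"

text \<open>nu_pairs t a: pairs (leaf label, branch-left count); a is the count for the
  current vertex (root/left child: 0, right child: parent's count + 1).\<close>
fun nu_pairs :: "itree \<Rightarrow> nat \<Rightarrow> (nat \<times> nat) set" where
  "nu_pairs (Leaf l) a = {(l, a)}"
| "nu_pairs (Node L R) a = nu_pairs L 0 \<union> nu_pairs R (Suc a)"

definition nu :: "chord set \<Rightarrow> nat \<Rightarrow> nat" where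
  "nu C i = (THE v. (i, v) \<in> nu_pairs (ins_tree C) 0)"

section \<open>Weights, monomials, generating series\<close>

text \<open>In a Q-algebra, qinv n is the inverse of the integer n (n > 0).\<close>
definition qinv :: "nat \<Rightarrow> 'a::comm_ring_1" where
  "qinv n = (THE u. of_nat n * u = 1)"

text \<open>binom(y, n) = y(y-1)...(y-n+1)/n! in A.\<close>
definition binomA :: "int \<Rightarrow> nat \<Rightarrow> 'a::comm_ring_1" where
  "binomA y n = of_int (\<Prod>j<n. y - int j) * qinv (fact n)"

definition dec_ok :: "nat \<Rightarrow> (nat \<Rightarrow> nat) \<Rightarrow> bool" where
  "dec_ok n d \<longleftrightarrow> (\<forall>i\<in>{1..n}. d i > 0) \<and> (\<forall>i. i \<notin> {1..n} \<longrightarrow> d i = 0)"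

definition omega :: "int \<Rightarrow> chord set \<Rightarrow> (nat \<Rightarrow> nat) \<Rightarrow> 'a::comm_ring_1" where
  "omega s C d = (\<Prod>i\<in>{1..card C}. binomA (s * int (d i) + int (nu C i) - 2) (nu C i))"

definition hat_a :: "(nat \<Rightarrow> nat \<Rightarrow> 'a::comm_ring_1) \<Rightarrow> chord set \<Rightarrow> (nat \<Rightarrow> nat) \<Rightarrow> 'a" where
  "hat_a a C d =
     (let T = term_labels C; t0 = Min T in
      (\<Prod>t\<in>T - {t0}. a (d t) (t - Max {t' \<in> T. t' < t})) * (\<Prod>i\<in>{1..card C} - T. a (d i) 0))"

text \<open>Decorated diagrams of total decoration N (decoration d i on chord with label i,
  d i = 0 outside the labels).\<close>
definition DD :: "nat \<Rightarrow> (chord set \<times> (nat \<Rightarrow> nat)) set" where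
  "DD N = {(C, d). rooted_connected (card C) C \<and> dec_ok (card C) d \<and> (\<Sum>i\<in>{1..card C}. d i) = N}"

definition gcomb :: "int \<Rightarrow> (nat \<Rightarrow> nat \<Rightarrow> 'a::comm_ring_1) \<Rightarrow> nat \<Rightarrow> 'a fps" where
  "gcomb s a k = Abs_fps (\<lambda>N. \<Sum>(C, d) \<in> {(C, d) \<in> DD N. base C \<ge> k}.
       omega s C d * hat_a a C d * a (d (base C)) (base C - k))"

end

theory Submission
  imports Defs
begin

text \<open>
  The root share decomposition is a bijection between the rooted connected diagrams with at least two
  chords and the triples \<open>(C, k, D)\<close> with \<open>1 \<le> k \<le> 2|D| - 1\<close>. In \<open>C \<circ>\<^sub>k D\<close> the root keeps label 1, the chords
  of \<open>D\<close> take the labels \<open>2, \<dots>, |D| + 1\<close>, and the other chords of \<open>C\<close> follow. Chords keep their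
  terminal status, except that the root is never terminal. Since the last chord of \<open>D\<close> is terminal, the
  gap between the terminal labels of \<open>D\<close> and those of \<open>C\<close> is \<open>b(C) - 1\<close>. Hence the monomial of \<open>C \<circ>\<^sub>k D\<close>
  for \<open>g\<^bsub>j+1\<^esub>\<close> is the product of that of \<open>C\<close> for \<open>g\<^sub>1\<close> and that of \<open>D\<close> for \<open>g\<^sub>j\<close>.

  On insertion trees, grafting at an edge raises the branch-left count of exactly one leaf \<open>j\<close> of \<open>T(D)\<close>
  by one, and each leaf \<open>j\<close> arises from \<open>\<nu>\<^sub>j + 1\<close> edges. As
  \<open>(\<nu> + 1) binom(sd + \<nu> - 1, \<nu> + 1) = (sd + \<nu> - 1) binom(sd + \<nu> - 2, \<nu>)\<close> and the counts of \<open>T(D)\<close> add up to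
  \<open>|D| - 1\<close>, summing the weight over all \<open>k\<close> multiplies \<open>\<omega>(C) \<omega>(D)\<close> by \<open>s \<parallel>D\<parallel> - 1\<close>, which is how
  \<open>s x \<partial>\<^sub>x - 1\<close> acts on \<open>x\<^bsup>\<parallel>D\<parallel>\<^esup>\<close>.
\<close>

section \<open>Sets of disjoint chords and monotone renaming of their endpoints\<close>

section \<open>Chord systems\<close>

text \<open>A chord diagram without the condition that the endpoints fill an initial segment. The
  notion passes to subsets, so components and their complements can be treated before
  normalisation.\<close>

definition chord_system :: "chord set \<Rightarrow> bool" where
  "chord_system S \<longleftrightarrow> finite S \<and> (\<forall>c\<in>S. fst c < snd c)
     \<and> (\<forall>c\<in>S. \<forall>c'\<in>S. c \<noteq> c' \<longrightarrow> {fst c, snd c} \<inter> {fst c', snd c'} = {})"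

text \<open>Normalisation and both halves of an insertion are renamings of this kind by strictly
  monotone maps, so whatever depends only on the relative order of endpoints is transported along
  \<open>mapc h\<close>.\<close>

definition mapc :: "(nat \<Rightarrow> nat) \<Rightarrow> chord \<Rightarrow> chord" where
  "mapc h c = (h (fst c), h (snd c))"

lemma fst_mapc [simp]: "fst (mapc h c) = h (fst c)"
  and snd_mapc [simp]: "snd (mapc h c) = h (snd c)"
  by (simp_all add: mapc_def)

lemma is_chord_diagram_alt:
  "is_chord_diagram n C \<longleftrightarrow> chord_system C \<and> card C = n \<and> endpoints C = {1..2*n}"
  unfolding is_chord_diagram_def chord_system_def by blast

lemma rooted_connected_alt:
  "rooted_connected n C \<longleftrightarrow>
     n \<ge> 1 \<and> chord_system C \<and> card C = n \<and> endpoints C = {1..2*n} \<and> connected_chords C"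
  unfolding rooted_connected_def is_chord_diagram_alt by blast

lemma chord_system_subset: "chord_system S \<Longrightarrow> K \<subseteq> S \<Longrightarrow> chord_system K"
  unfolding chord_system_def by (blast intro: finite_subset)

lemma chord_system_finite: "chord_system S \<Longrightarrow> finite S"
  unfolding chord_system_def by blast

lemma chord_system_less: "chord_system S \<Longrightarrow> c \<in> S \<Longrightarrow> fst c < snd c"
  unfolding chord_system_def by blast

lemma chord_system_disjoint:
  assumes "chord_system S" "c \<in> S" "c' \<in> S" "c \<noteq> c'"
  shows "fst c \<noteq> fst c'" "fst c \<noteq> snd c'" "snd c \<noteq> fst c'" "snd c \<noteq> snd c'"
proof -
  have "{fst c, snd c} \<inter> {fst c', snd c'} = {}"
    using assms unfolding chord_system_def by blast
  then show "fst c \<noteq> fst c'" "fst c \<noteq> snd c'" "snd c \<noteq> fst c'" "snd c \<noteq> snd c'"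
    by auto
qed

lemma endpoints_Un: "endpoints (A \<union> B) = endpoints A \<union> endpoints B"
  unfolding endpoints_def by auto

lemma endpoints_mono: "A \<subseteq> B \<Longrightarrow> endpoints A \<subseteq> endpoints B"
  unfolding endpoints_def by auto

lemma endpointsI: "c \<in> S \<Longrightarrow> fst c \<in> endpoints S" "c \<in> S \<Longrightarrow> snd c \<in> endpoints S"
  unfolding endpoints_def by auto

lemma endpointsE:
  assumes "p \<in> endpoints S"
  obtains c where "c \<in> S" "p = fst c \<or> p = snd c"
  using assms unfolding endpoints_def by blast

lemma endpoints_mapc: "endpoints (mapc h ` S) = h ` endpoints S"
  unfolding endpoints_def by (simp add: image_Un image_image)

lemma finite_endpoints: "finite S \<Longrightarrow> finite (endpoints S)"
  unfolding endpoints_def by simp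

lemma endpoints_disjoint:
  assumes "chord_system S" "A \<subseteq> S" "B \<subseteq> S" "A \<inter> B = {}"
  shows "endpoints A \<inter> endpoints B = {}"
proof -
  have False if p: "p \<in> endpoints A" "p \<in> endpoints B" for p
  proof -
    obtain c where c: "c \<in> A" "p = fst c \<or> p = snd c" using endpointsE[OF p(1)] by blast
    obtain c' where c': "c' \<in> B" "p = fst c' \<or> p = snd c'" using endpointsE[OF p(2)] by blast
    have "c \<noteq> c'" "c \<in> S" "c' \<in> S" using assms c c' by auto
    from chord_system_disjoint[OF assms(1) this(2,3,1)] c(2) c'(2) show False by auto
  qed
  then show ?thesis by blast
qed

lemma crosses_sym: "crosses c c' \<longleftrightarrow> crosses c' c"
  unfolding crosses_def by blast

lemma crosses_mapc:
  assumes "strict_mono_on (endpoints S) h" "c \<in> S" "c' \<in> S"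
  shows "crosses (mapc h c) (mapc h c') \<longleftrightarrow> crosses c c'"
  using assms endpointsI[of c S] endpointsI[of c' S]
  by (simp add: crosses_def strict_mono_on_less)

section \<open>Roots\<close>

lemma root_props:
  assumes "chord_system S" "S \<noteq> {}"
  shows "root S \<in> S" "\<And>c. c \<in> S \<Longrightarrow> fst (root S) \<le> fst c"
proof -
  have "finite (fst ` S)" "fst ` S \<noteq> {}" using assms chord_system_finite by auto
  from Min_in[OF this] obtain c where c: "c \<in> S" "fst c = Min (fst ` S)" by auto
  have "\<forall>c'\<in>S. fst c \<le> fst c'"
    using c(2) \<open>finite (fst ` S)\<close> by auto
  with c(1) have "\<exists>c. c \<in> S \<and> (\<forall>c'\<in>S. fst c \<le> fst c')" by blast
  from someI_ex[OF this] show "root S \<in> S" "\<And>c. c \<in> S \<Longrightarrow> fst (root S) \<le> fst c"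
    unfolding root_def by auto
qed

text \<open>Distinct chords have distinct left endpoints, so the choice operator in
  \<open>root\<close> has only one candidate.\<close>

lemma root_eqI:
  assumes "chord_system S" "c \<in> S" "\<And>c'. c' \<in> S \<Longrightarrow> fst c \<le> fst c'"
  shows "root S = c"
  using root_props[OF assms(1)] assms chord_system_disjoint(1)[OF assms(1)]
  by (metis empty_iff le_antisym)

lemma root_mapc:
  assumes S: "chord_system S" "S \<noteq> {}" and h: "strict_mono_on (endpoints S) h"
    and hS: "chord_system (mapc h ` S)"
  shows "root (mapc h ` S) = mapc h (root S)"
proof (rule root_eqI[OF hS])
  show "mapc h (root S) \<in> mapc h ` S" using root_props[OF S] by blast
  show "fst (mapc h (root S)) \<le> fst c'" if c': "c' \<in> mapc h ` S" for c'
  proof -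
    obtain c where c: "c \<in> S" "c' = mapc h c" using c' by blast
    have "h (fst (root S)) \<le> h (fst c)"
      using strict_mono_on_leD[OF h] root_props[OF S] endpointsI c(1) by blast
    then show ?thesis using c by simp
  qed
qed

lemma inj_on_mapc:
  assumes "strict_mono_on (endpoints S) h"
  shows "inj_on (mapc h) S"
proof (rule inj_onI)
  fix x y assume xy: "x \<in> S" "y \<in> S" "mapc h x = mapc h y"
  have inj: "inj_on h (endpoints S)" using assms by (rule strict_mono_on_imp_inj_on)
  have "h (fst x) = h (fst y)" "h (snd x) = h (snd y)" 
    using xy(3) by (simp_all add: prod_eq_iff)
  then have "fst x = fst y" "snd x = snd y" 
    using inj_onD[OF inj] endpointsI xy(1,2) by blast+
  then show "x = y" by (simp add: prod_eq_iff)
qed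

lemma chord_system_mapc:
  assumes S: "chord_system S" and h: "strict_mono_on (endpoints S) h"
  shows "chord_system (mapc h ` S)"
  unfolding chord_system_def
proof (intro conjI ballI impI)
  show "finite (mapc h ` S)" using chord_system_finite[OF S] by simp
  show "fst c < snd c" if "c \<in> mapc h ` S" for c
    using that chord_system_less[OF S] strict_mono_onD[OF h] endpointsI by fastforce
  fix c c' assume c: "c \<in> mapc h ` S" "c' \<in> mapc h ` S" "c \<noteq> c'"
  then obtain x y where xy: "x \<in> S" "c = mapc h x" "y \<in> S" "c' = mapc h y" by blast
  then have "x \<noteq> y" using c by blast
  have inj: "inj_on h (endpoints S)" using h by (rule strict_mono_on_imp_inj_on)
  show "{fst c, snd c} \<inter> {fst c', snd c'} = {}"
    using chord_system_disjoint[OF S xy(1,3) \<open>x \<noteq> y\<close>] inj_on_eq_iff[OF inj] endpointsI xy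
    by auto
qed

section \<open>Crossing paths, connected components and their transport\<close>

section \<open>Components\<close>

lemma cross_rel_sym: "sym (cross_rel S)"
  unfolding cross_rel_def sym_def by (auto simp: crosses_sym)

lemma cross_path_sym: "(c, c') \<in> (cross_rel S)\<^sup>* \<Longrightarrow> (c', c) \<in> (cross_rel S)\<^sup>*"
  using sym_rtrancl[OF cross_rel_sym] by (rule symD)

lemma cross_rel_mono: "A \<subseteq> B \<Longrightarrow> cross_rel A \<subseteq> cross_rel B"
  unfolding cross_rel_def by auto

lemma cross_path_mono: "A \<subseteq> B \<Longrightarrow> (c, c') \<in> (cross_rel A)\<^sup>* \<Longrightarrow> (c, c') \<in> (cross_rel B)\<^sup>*"
  using rtrancl_mono[OF cross_rel_mono] by blast

text \<open>A path that starts in a set with no crossings to the rest can never leave it. This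
  serves both to restrict paths to a component and to derive contradictions from
  connectedness.\<close>

lemma cross_path_closed:
  assumes "(c, c') \<in> (cross_rel S)\<^sup>*" "c \<in> K" "\<And>x y. x \<in> K \<Longrightarrow> y \<in> S - K \<Longrightarrow> \<not> crosses x y"
  shows "c' \<in> K \<and> (c, c') \<in> (cross_rel K)\<^sup>*"
  using assms(1)
proof (induction rule: rtrancl_induct)
  case base
  then show ?case using assms(2) by simp
next
  case (step y z)
  have "z \<in> K" using step assms(3)[of y z] by (auto simp: cross_rel_def)
  then have "(y, z) \<in> cross_rel K" using step by (auto simp: cross_rel_def)
  then show ?case using step \<open>z \<in> K\<close> by auto
qed

lemma comp_subset: "comp S c \<subseteq> S"
  unfolding comp_def by blast

lemma comp_self: "c \<in> S \<Longrightarrow> c \<in> comp S c"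
  unfolding comp_def by blast

lemma comp_no_cross:
  assumes "x \<in> comp S c" "y \<in> S - comp S c"
  shows "\<not> crosses x y"
proof
  assume "crosses x y"
  with assms have "(x, y) \<in> cross_rel S" by (auto simp: cross_rel_def comp_def)
  with assms show False unfolding comp_def by (auto intro: rtrancl_into_rtrancl)
qed

lemma connected_comp:
  assumes "c \<in> S"
  shows "connected_chords (comp S c)"
  unfolding connected_chords_def
proof (intro ballI)
  fix x y assume x: "x \<in> comp S c" and y: "y \<in> comp S c"
  have "(c, x) \<in> (cross_rel (comp S c))\<^sup>*" "(c, y) \<in> (cross_rel (comp S c))\<^sup>*"
    using x y cross_path_closed[of c _ S "comp S c"] comp_self[OF assms] comp_no_cross
    unfolding comp_def by blast+
  then show "(x, y) \<in> (cross_rel (comp S c))\<^sup>*"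
    using cross_path_sym rtrancl_trans by metis
qed

lemma comp_eqI:
  assumes "K \<subseteq> S" "connected_chords K" "\<And>x y. x \<in> K \<Longrightarrow> y \<in> S - K \<Longrightarrow> \<not> crosses x y" "c \<in> K"
  shows "comp S c = K"
proof
  show "comp S c \<subseteq> K"
    using cross_path_closed[OF _ assms(4,3)] unfolding comp_def by blast
  show "K \<subseteq> comp S c"
    using assms cross_path_mono[OF assms(1)] unfolding comp_def connected_chords_def by blast
qed

lemma comp_Diff:
  assumes "K \<subseteq> S" "\<And>x y. x \<in> K \<Longrightarrow> y \<in> S - K \<Longrightarrow> \<not> crosses x y" "c \<in> S - K"
  shows "comp S c = comp (S - K) c"
proof
  show "comp S c \<subseteq> comp (S - K) c"
    using cross_path_closed[of c _ S "S - K"] assms crosses_sym unfolding comp_def by blast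
  show "comp (S - K) c \<subseteq> comp S c"
    using cross_path_mono[of "S - K" S] unfolding comp_def by blast
qed

text \<open>No crossing path joins \<open>K\<close> to its complement, so taking \<open>K\<close>
  away leaves the components of the other chords as they are.\<close>

lemma components_split:
  assumes "K \<subseteq> S" "K \<noteq> {}" "connected_chords K"
    and "\<And>x y. x \<in> K \<Longrightarrow> y \<in> S - K \<Longrightarrow> \<not> crosses x y"
  shows "components S = insert K (components (S - K))"
proof -
  have "components S = comp S ` K \<union> comp S ` (S - K)"
    using assms(1) unfolding components_def by blast
  also have "comp S ` K = {K}"
    using comp_eqI[OF assms(1,3,4)] assms(2) by auto
  also have "comp S ` (S - K) = components (S - K)"
    using comp_Diff[OF assms(1,4)] unfolding components_def by (auto intro!: image_cong)
  finally show ?thesis by simp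
qed

lemma components_props:
  assumes "K \<in> components S"
  shows "K \<subseteq> S" "K \<noteq> {}" "connected_chords K" "\<And>x y. x \<in> K \<Longrightarrow> y \<in> S - K \<Longrightarrow> \<not> crosses x y"
proof -
  obtain c where c: "c \<in> S" "K = comp S c" using assms unfolding components_def by blast
  show "K \<subseteq> S" using c comp_subset by simp
  show "K \<noteq> {}" using c comp_self by blast
  show "connected_chords K" using c connected_comp by simp
  show "\<not> crosses x y" if "x \<in> K" "y \<in> S - K" for x y
    using that c comp_no_cross by simp
qed

lemma cross_path_mapc:
  assumes h: "strict_mono_on (endpoints S) h" and c: "c \<in> S" "c' \<in> S"
  shows "(mapc h c, mapc h c') \<in> (cross_rel (mapc h ` S))\<^sup>* \<longleftrightarrow> (c, c') \<in> (cross_rel S)\<^sup>*"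
proof
  assume "(c, c') \<in> (cross_rel S)\<^sup>*"
  then show "(mapc h c, mapc h c') \<in> (cross_rel (mapc h ` S))\<^sup>*"
  proof (induction rule: rtrancl_induct)
    case (step y z)
    then have "(mapc h y, mapc h z) \<in> cross_rel (mapc h ` S)"
      using crosses_mapc[OF h] by (auto simp: cross_rel_def)
    with step.IH show ?case by (rule rtrancl_into_rtrancl)
  qed simp
next
  \<comment> \<open>Every vertex on a path in the image is lifted back to \<open>S\<close>;
    injectivity then identifies the end of the path.\<close>
  have "\<exists>x\<in>S. z = mapc h x \<and> (c, x) \<in> (cross_rel S)\<^sup>*"
    if "(mapc h c, z) \<in> (cross_rel (mapc h ` S))\<^sup>*" for z
    using that
  proof (induction rule: rtrancl_induct)
    case base
    then show ?case using c by blast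
  next
    case (step y z)
    from step.IH obtain x where x: "x \<in> S" "y = mapc h x" "(c, x) \<in> (cross_rel S)\<^sup>*" by blast
    from step.hyps obtain w where w: "w \<in> S" "z = mapc h w" "crosses y z"
      unfolding cross_rel_def by blast
    then have "(x, w) \<in> cross_rel S" using x crosses_mapc[OF h] by (simp add: cross_rel_def)
    then show ?case using x w by (blast intro: rtrancl_into_rtrancl)
  qed
  moreover assume "(mapc h c, mapc h c') \<in> (cross_rel (mapc h ` S))\<^sup>*"
  ultimately show "(c, c') \<in> (cross_rel S)\<^sup>*"
    using inj_onD[OF inj_on_mapc[OF h]] c by blast
qed

lemma connected_mapc:
  assumes "strict_mono_on (endpoints S) h"
  shows "connected_chords (mapc h ` S) \<longleftrightarrow> connected_chords S"
  using cross_path_mapc[OF assms] unfolding connected_chords_def by blast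

lemma comp_mapc:
  assumes "strict_mono_on (endpoints S) h" "c \<in> S"
  shows "comp (mapc h ` S) (mapc h c) = mapc h ` comp S c"
  using cross_path_mapc[OF assms(1,2)] unfolding comp_def by blast

lemma components_mapc:
  assumes "strict_mono_on (endpoints S) h"
  shows "components (mapc h ` S) = (`) (mapc h) ` components S"
  unfolding components_def image_image by (intro image_cong refl) (rule comp_mapc[OF assms])

lemma minpt_in: "finite K \<Longrightarrow> K \<noteq> {} \<Longrightarrow> minpt K \<in> endpoints K"
  unfolding minpt_def by (intro Min_in finite_endpoints) (auto simp: endpoints_def)

lemma minpt_mapc:
  assumes "strict_mono_on (endpoints K) h" "finite K" "K \<noteq> {}"
  shows "minpt (mapc h ` K) = h (minpt K)"
proof -
  have "finite (endpoints K)" "endpoints K \<noteq> {}"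
    using assms finite_endpoints by (auto simp: endpoints_def)
  moreover have "h (Min (endpoints K)) \<le> h p" if "p \<in> endpoints K" for p
    using that calculation strict_mono_on_leD[OF assms(1)] by simp
  ultimately show ?thesis unfolding minpt_def endpoints_mapc
    by (intro Min_eqI) auto
qed

section \<open>Order invariance of the labels and their recursion without fuel\<close>

section \<open>The intersection order\<close>

text \<open>The recursion uses only roots, components, their sizes and the order of their smallest
  endpoints, all of which a monotone renaming preserves. Both sides carry the same fuel, so the
  induction is on \<open>f\<close> alone.\<close>

lemma lab_fuel_mapc:
  assumes "chord_system S" "S \<noteq> {}" "strict_mono_on (endpoints S) h" "c \<in> S"
  shows "lab_fuel f (mapc h ` S) (mapc h c) = lab_fuel f S c"
  using assms
proof (induction f arbitrary: S c)
  case 0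
  then show ?case by simp
next
  case (Suc f)
  note S = Suc.prems(1,2) and h = Suc.prems(3) and c = Suc.prems(4)
  note inj = inj_on_mapc[OF h]
  have rt: "root (mapc h ` S) = mapc h (root S)"
    using root_mapc[OF S h chord_system_mapc[OF S(1) h]] .
  have rS: "root S \<in> S" using root_props(1)[OF S] .
  show ?case
  proof (cases "c = root S")
    case True
    then show ?thesis using rt by simp
  next
    case False
    define R where "R = S - {root S}"
    define K where "K = comp R c"
    have R: "R \<subseteq> S" "c \<in> R" using False c by (auto simp: R_def)
    have hR: "strict_mono_on (endpoints R) h"
      using h endpoints_mono[OF R(1)] monotone_on_subset by blast
    have R': "mapc h ` S - {root (mapc h ` S)} = mapc h ` R"
      using inj rS by (auto simp: R_def rt inj_on_def)
    have K': "comp (mapc h ` R) (mapc h c) = mapc h ` K"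
      using comp_mapc[OF hR R(2)] by (simp add: K_def)
    have KR: "K \<subseteq> R" "c \<in> K" using comp_subset comp_self R(2) by (auto simp: K_def)
    have finS: "finite S" using S chord_system_finite by blast
    have hL: "strict_mono_on (endpoints L) h" if "L \<subseteq> S" for L
      using h endpoints_mono[OF that] monotone_on_subset by blast
    have minpt: "minpt (mapc h ` L) < minpt (mapc h ` K) \<longleftrightarrow> minpt L < minpt K"
      if "L \<subseteq> R" "L \<noteq> {}" for L
    proof -
      have fin: "finite L" "finite K"
        using that KR R finS finite_subset[of L S] finite_subset[of K S] by auto
      have ne: "L \<noteq> {}" "K \<noteq> {}" using that KR by blast+
      have "minpt L \<in> endpoints S" "minpt K \<in> endpoints S"
        using minpt_in[OF fin(1) ne(1)] minpt_in[OF fin(2) ne(2)]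
          endpoints_mono[of L S] endpoints_mono[of K S] that KR R by auto
      then show ?thesis
        using minpt_mapc[OF hL] fin ne that KR R strict_mono_on_less[OF h] by simp
    qed
    have comps: "{K' \<in> components (mapc h ` R). minpt K' < minpt (mapc h ` K)}
               = (`) (mapc h) ` {K' \<in> components R. minpt K' < minpt K}"
    proof -
      have "minpt (mapc h ` L) < minpt (mapc h ` K) \<longleftrightarrow> minpt L < minpt K" if "L \<in> components R" for L
        using minpt components_props(1,2)[OF that] by simp
      then show ?thesis unfolding components_mapc[OF hR] by blast
    qed
    have injR: "inj_on ((`) (mapc h)) {K' \<in> components R. minpt K' < minpt K}"
    proof (rule inj_on_subset[OF inj_on_image_Pow[OF inj_on_subset[OF inj R(1)]]])
      show "{K' \<in> components R. minpt K' < minpt K} \<subseteq> Pow R"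
        using components_props(1) by fast
    qed
    have card: "card (mapc h ` K') = card K'" if "K' \<in> components R" for K'
      using card_image inj_on_subset[OF inj] components_props(1)[OF that] R by (metis subset_trans)
    have "lab_fuel f (mapc h ` K) (mapc h c) = lab_fuel f K c"
    proof (rule Suc.IH)
      show "chord_system K" "strict_mono_on (endpoints K) h"
        using chord_system_subset[OF S(1), of K] hL[of K] KR R by auto
    qed (use KR in auto)
    moreover have "(\<Sum>K'\<in>{K' \<in> components (mapc h ` R). minpt K' < minpt (mapc h ` K)}. card K')
        = (\<Sum>K'\<in>{K' \<in> components R. minpt K' < minpt K}. card K')"
      unfolding comps sum.reindex[OF injR] using card by (intro sum.cong) auto
    moreover have "mapc h c \<noteq> root (mapc h ` S)"
      using False rt inj_on_eq_iff[OF inj c rS] by simp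
    ultimately show ?thesis using False K' by (simp add: R' Let_def flip: R_def K_def)
  qed
qed

lemma label_mapc:
  assumes "chord_system S" "strict_mono_on (endpoints S) h" "c \<in> S"
  shows "label (mapc h ` S) (mapc h c) = label S c"
  unfolding label_def card_image[OF inj_on_mapc[OF assms(2)]]
  using lab_fuel_mapc assms by blast

text \<open>Each call passes to a component avoiding the root, hence to a smaller set, so fuel
  beyond \<open>card S\<close> changes nothing.\<close>

lemma lab_fuel_enough:
  assumes "chord_system S" "c \<in> S" "card S \<le> f"
  shows "lab_fuel f S c = label S c"
  using assms
proof (induction "card S" arbitrary: S c f rule: less_induct)
  case less
  note S = less.prems(1) and c = less.prems(2)
  have rS: "root S \<in> S" using root_props(1)[OF S] c by blast
  have fin: "finite S" using S chord_system_finite by blast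
  then have "card S > 0" using c by (auto simp: card_gt_0_iff)
  then obtain g f' where gf: "card S = Suc g" "f = Suc f'" "g \<le> f'"
    using less.prems(3) by (cases "card S"; cases f) auto
  show ?case
  proof (cases "c = root S")
    case True
    then show ?thesis using gf by (simp add: label_def)
  next
    case False
    let ?K = "comp (S - {root S}) c"
    have K: "c \<in> ?K" "?K \<subseteq> S - {root S}" using False c comp_self comp_subset by auto
    have "card ?K \<le> g" using card_mono[OF _ K(2)] fin rS gf by simp
    moreover have "chord_system ?K" using chord_system_subset[OF S] K by blast
    ultimately have "lab_fuel g ?K c = label ?K c" "lab_fuel f' ?K c = label ?K c"
      using less.hyps[of ?K c] K gf by auto
    then show ?thesis using False gf by (simp add: label_def Let_def)
  qed
qed

lemma label_root: "c = root S \<Longrightarrow> label S c = 1"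
  by (cases "card S") (simp_all add: label_def)

lemma label_rec:
  assumes S: "chord_system S" and c: "c \<in> S" "c \<noteq> root S"
    and K: "K = comp (S - {root S}) c"
  shows "label S c = 1 + (\<Sum>K'\<in>{K' \<in> components (S - {root S}). minpt K' < minpt K}. card K') + label K c"
proof -
  have rS: "root S \<in> S" using root_props(1)[OF S] c by blast
  have fin: "finite S" using S chord_system_finite by blast
  then have "card S > 0" using c by (auto simp: card_gt_0_iff)
  then obtain g where g: "card S = Suc g" by (cases "card S") auto
  have K': "c \<in> K" "K \<subseteq> S - {root S}" using c comp_self comp_subset K by auto
  have "card K \<le> g" using card_mono[OF _ K'(2)] fin rS g by simp
  then have "lab_fuel g K c = label K c" 
    using lab_fuel_enough chord_system_subset[OF S] K' by blast
  then show ?thesis using g c K by (simp add: label_def Let_def)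
qed

section \<open>Splitting off the first component \<open>K\<close>; the witness \<open>p\<close>
  certifies that \<open>K\<close> comes first\<close>

context
  fixes S K :: "chord set" and p :: nat
  assumes S: "chord_system S" and K: "K \<subseteq> S - {root S}" "connected_chords K"
    and nc: "\<And>x y. x \<in> K \<Longrightarrow> y \<in> S - {root S} - K \<Longrightarrow> \<not> crosses x y"
    and p: "p \<in> endpoints K" "\<And>q. q \<in> endpoints (S - {root S} - K) \<Longrightarrow> p < q"
begin

private lemma K_ne: "K \<noteq> {}"
  using p(1) by (auto simp: endpoints_def)

private lemma finS: "finite S"
  using S chord_system_finite by blast

private lemma minpt_less:
  assumes "L \<in> components (S - {root S} - K)"
  shows "minpt K < minpt L"
proof -
  note L = components_props(1,2)[OF assms]
  have fin: "finite K" "finite L"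
    using finS K L finite_subset[of K S] finite_subset[of L S] by auto
  have "minpt K \<le> p" unfolding minpt_def using fin p(1) finite_endpoints by simp
  moreover have "p < minpt L" using p(2) endpoints_mono[OF L(1)] minpt_in[OF fin(2) L(2)] by blast
  ultimately show ?thesis by simp
qed

private lemma comps: "components (S - {root S}) = insert K (components (S - {root S} - K))"
  using components_split[OF K(1) K_ne K(2) nc] by simp

lemma first_comp_split: "first_comp (S - {root S}) = K"
  unfolding first_comp_def
proof (rule some_equality)
  show "K \<in> components (S - {root S}) \<and> (\<forall>K'\<in>components (S - {root S}). minpt K \<le> minpt K')"
    using minpt_less comps by (auto intro: less_imp_le)
  show "L = K" if L: "L \<in> components (S - {root S}) \<and> (\<forall>K'\<in>components (S - {root S}). minpt L \<le> minpt K')" for L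
  proof (rule ccontr)
    assume "L \<noteq> K"
    then have "minpt K < minpt L" using L comps minpt_less by blast
    moreover have "minpt L \<le> minpt K" using L comps by blast
    ultimately show False by simp
  qed
qed

text \<open>Only the root is labelled before the block of \<open>K\<close>, which accounts for the
  single \<open>Suc\<close>.\<close>

lemma label_first_comp:
  assumes c: "c \<in> K"
  shows "label S c = Suc (label K c)"
proof -
  have "comp (S - {root S}) c = K" using comp_eqI[OF K nc c] by simp
  moreover have none: "{K' \<in> components (S - {root S}). minpt K' < minpt K} = {}"
    using comps minpt_less by fastforce
  moreover have "c \<in> S" "c \<noteq> root S" using c K by auto
  ultimately show ?thesis using label_rec[OF S, of c K] unfolding none by simp
qed

text \<open>The block of \<open>K\<close> precedes those of all other components. Deleting
  \<open>K\<close> keeps the root and the other components, so the remaining nonroot labels drop by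
  exactly \<open>card K\<close>.\<close>

lemma label_rest:
  assumes c: "c \<in> S - K"
  shows "label S c = (if c = root S then 1 else card K + label (S - K) c)"
proof (cases "c = root S")
  case True
  then show ?thesis using label_root by simp
next
  case False
  have S': "chord_system (S - K)" using chord_system_subset[OF S] by blast
  have rS: "root S \<in> S" using root_props(1)[OF S] c by blast
  have rt: "root (S - K) = root S"
    using root_eqI[OF S'] root_props[OF S] c K(1) by blast
  have R: "S - K - {root (S - K)} = S - {root S} - K" unfolding rt by blast
  let ?L = "comp (S - {root S} - K) c"
  have L: "comp (S - {root S}) c = ?L" 
    by (rule comp_Diff[OF K(1) nc]) (use c False in auto)
  have Lc: "?L \<in> components (S - {root S} - K)" using c False by (auto simp: components_def)
  let ?P = "{K' \<in> components (S - {root S} - K). minpt K' < minpt ?L}"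
  \<comment> \<open>\<open>K\<close> has the smallest endpoint of all components, so it is among the
    predecessors of every other one.\<close>
  have "{K' \<in> components (S - {root S}). minpt K' < minpt ?L} = insert K ?P"
    using comps minpt_less[OF Lc] by auto
  moreover have "K \<notin> ?P" using minpt_less by auto
  moreover have "finite ?P" unfolding components_def using finS by simp
  ultimately have "label S c = 1 + (card K + (\<Sum>K'\<in>?P. card K')) + label ?L c"
    using label_rec[OF S _ False L[symmetric]] c by simp
  moreover have "label (S - K) c = 1 + (\<Sum>K'\<in>?P. card K') + label ?L c"
    using label_rec[OF S' c, of ?L] False rt R by simp
  ultimately show ?thesis using False by simp
qed

end

section \<open>The inserted diagram: connectedness, recovery of its parts, labels\<close>

section \<open>Insertion of rooted connected diagrams\<close>

lemma rooted_connectedD: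
  assumes "rooted_connected n C"
  shows "n \<ge> 1" "chord_system C" "card C = n" "endpoints C = {1..2*n}" "connected_chords C" "C \<noteq> {}" "finite C"
  using assms chord_system_finite unfolding rooted_connected_alt by auto

lemma rooted_connected_root:
  assumes "rooted_connected n C"
  shows "root C \<in> C" "fst (root C) = 1" "\<And>c. c \<in> C \<Longrightarrow> 1 < snd c"
    "\<And>c. c \<in> C \<Longrightarrow> c \<noteq> root C \<Longrightarrow> 1 < fst c"
proof -
  note C = rooted_connectedD[OF assms]
  note r = root_props[OF C(2,6)]
  show "root C \<in> C" using r(1) .
  have ge: "1 \<le> fst c" if "c \<in> C" for c using endpointsI(1)[OF that] C by simp
  show gt: "1 < snd c" if "c \<in> C" for c using ge[OF that] chord_system_less[OF C(2) that] by simp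
  have "1 \<in> endpoints C" using C by simp
  then obtain c where c: "c \<in> C" "1 = fst c \<or> 1 = snd c" using endpointsE by blast
  then have "fst c = 1" using gt[OF c(1)] by auto
  then show *: "fst (root C) = 1" using r(2)[OF c(1)] ge[OF r(1)] by simp
  show "1 < fst c" if "c \<in> C" "c \<noteq> root C" for c
    using chord_system_disjoint(1)[OF C(2) that(1) r(1) that(2)] ge[OF that(1)] * by simp
qed

lemma chord_system_Un:
  assumes "chord_system A" "chord_system B" "endpoints A \<inter> endpoints B = {}"
  shows "chord_system (A \<union> B)"
proof -
  have AB: "{fst c, snd c} \<inter> {fst c', snd c'} = {}" if "c \<in> A" "c' \<in> B" for c c'
  proof -
    have "{fst c, snd c} \<subseteq> endpoints A" "{fst c', snd c'} \<subseteq> endpoints B"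
      using endpointsI that by auto
    then show ?thesis using assms(3) by blast
  qed
  have "{fst c, snd c} \<inter> {fst c', snd c'} = {}" if cc: "c \<in> A \<union> B" "c' \<in> A \<union> B" "c \<noteq> c'" for c c'
  proof -
    consider "c \<in> A" "c' \<in> A" | "c \<in> B" "c' \<in> B" | "c \<in> A" "c' \<in> B" | "c' \<in> A" "c \<in> B"
      using cc(1,2) by blast
    then show ?thesis
    proof cases
      case 1 then show ?thesis using assms(1) cc(3) unfolding chord_system_def by simp
    next
      case 2 then show ?thesis using assms(2) cc(3) unfolding chord_system_def by simp
    next
      case 3 then show ?thesis by (rule AB)
    next
      case 4 then show ?thesis using AB[of c' c] by (simp add: Int_commute)
    qed
  qed
  moreover have "finite (A \<union> B)" "\<forall>c\<in>A \<union> B. fst c < snd c"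
    using assms(1,2) chord_system_finite chord_system_less by auto
  ultimately show ?thesis unfolding chord_system_def by simp
qed

lemma connected_chords_via:
  assumes "\<And>c. c \<in> S \<Longrightarrow> (c, r) \<in> (cross_rel S)\<^sup>*"
  shows "connected_chords S"
  unfolding connected_chords_def
  by (intro ballI rtrancl_trans[OF assms cross_path_sym[OF assms]])

lemma rank_mono_image:
  assumes "strict_mono_on {1..N} h" "p \<in> {1..N}"
  shows "rank (h ` {1..N}) (h p) = p"
proof -
  have "{q \<in> h ` {1..N}. q < h p} = h ` {1..<p}"
    using strict_mono_on_less[OF assms(1) _ assms(2)] assms(2) by auto
  moreover have "inj_on h {1..<p}"
    using strict_mono_on_imp_inj_on[OF assms(1)] assms(2) by (auto intro: inj_on_subset)
  ultimately show ?thesis using assms(2) by (simp add: rank_def card_image)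
qed

text \<open>On the image of an initial segment \<open>rank\<close> inverts \<open>h\<close>. This is
  how the two parts of an insertion are recovered by normalisation.\<close>

lemma norm_mapc:
  assumes C: "endpoints C = {1..N}" and h: "strict_mono_on {1..N} h"
  shows "norm (mapc h ` C) = C" "\<And>c. c \<in> C \<Longrightarrow> denorm (mapc h ` C) c = mapc h c"
proof -
  have nc: "norm_chord (mapc h ` C) (mapc h c) = c" if "c \<in> C" for c
    using rank_mono_image[OF h] endpointsI[OF that] C
    by (simp add: norm_chord_def endpoints_mapc)
  then show "norm (mapc h ` C) = C" unfolding norm_def image_image by simp
  show "denorm (mapc h ` C) c = mapc h c" if "c \<in> C" for c
    unfolding denorm_def using that nc by (intro the_equality) auto
qed

text \<open>One monotone map for the root and the other chords of \<open>C\<close>, which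
  \<open>ins_chord\<close> treats separately: the left endpoint 1 of the root stays fixed. The test
  \<open>x \<le> 1\<close> also fixes 0, which keeps the map strictly monotone on all
  naturals.\<close>

definition outer_shift :: "nat \<Rightarrow> nat \<Rightarrow> nat" where
  "outer_shift k x = (if x \<le> 1 then x else x + k)"

text \<open>The map \<open>H\<close> of \<open>ins_chord\<close>. It leaves a gap after position
  \<open>k + 1\<close> for the \<open>2 * n - 1\<close> endpoints of \<open>C\<close> other than
  1.\<close>

definition inner_shift :: "nat \<Rightarrow> nat \<Rightarrow> nat \<Rightarrow> nat" where
  "inner_shift n k x = (if x \<le> k then x + 1 else x + 2 * n)"

lemma strict_mono_outer_shift: "strict_mono_on A (outer_shift k)"
  by (auto simp: strict_mono_on_def outer_shift_def)

lemma strict_mono_inner_shift: "n \<ge> 1 \<Longrightarrow> strict_mono_on A (inner_shift n k)"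
  by (auto simp: strict_mono_on_def inner_shift_def)

text \<open>Otherwise the chords ending by \<open>k\<close> would cross none of the others. They
  include the root but not the chord ending at \<open>2 * m\<close>, contradicting connectedness.
  The straddling chord later links \<open>D\<close> to the root of the insertion.\<close>

lemma connected_chords_straddle:
  assumes D: "rooted_connected m D" and k: "1 \<le> k" "k < 2 * m"
  shows "\<exists>d\<in>D. fst d \<le> k \<and> k < snd d"
proof (rule ccontr)
  assume no: "\<not> ?thesis"
  note D' = rooted_connectedD[OF D] and r = rooted_connected_root[OF D]
  define L where "L = {d \<in> D. snd d \<le> k}"
  have "2 * m \<in> endpoints D" using D' by simp
  then obtain c where c: "c \<in> D" "2 * m = fst c \<or> 2 * m = snd c" using endpointsE by blast
  then have "c \<notin> L" using chord_system_less[OF D'(2) c(1)] k by (auto simp: L_def)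
  have nc: "\<not> crosses x y" if "x \<in> L" "y \<in> D - L" for x y
  proof -
    have "fst x < snd x" "snd x \<le> k" "k < fst y"
      using that no chord_system_less[OF D'(2)] by (auto simp: L_def not_le)
    then show ?thesis by (auto simp: crosses_def)
  qed
  have rL: "root D \<in> L" using no r k by (force simp: L_def not_le)
  have "(root D, c) \<in> (cross_rel D)\<^sup>*" using D'(5) r(1) c(1) by (simp add: connected_chords_def)
  from cross_path_closed[OF this rL nc] \<open>c \<notin> L\<close> show False by simp
qed

text \<open>As a predicate, \<open>insertion n m k C D\<close> also describes the data produced by
  the root share decomposition.\<close>

locale insertion =
  fixes n m k :: nat and C D :: "chord set"
  assumes C: "rooted_connected n C" and D: "rooted_connected m D"
    and k: "1 \<le> k" "k \<le> 2 * m - 1"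
begin

lemmas C_facts = rooted_connectedD[OF C]
lemmas D_facts = rooted_connectedD[OF D]
lemmas C_root = rooted_connected_root[OF C]
lemmas D_root = rooted_connected_root[OF D]

abbreviation "h \<equiv> outer_shift k"
abbreviation "H \<equiv> inner_shift n k"
abbreviation "K \<equiv> mapc H ` D"
abbreviation "E \<equiv> ins_chord C k D"

lemma mono_h: "strict_mono_on A h" by (rule strict_mono_outer_shift)
lemma mono_H: "strict_mono_on A H" using C_facts by (intro strict_mono_inner_shift)

lemma ins_chord_eq: "E = mapc h ` C \<union> K"
proof -
  have "C = insert (root C) (C - {root C})" using C_root by blast
  then have "mapc h ` C = insert (mapc h (root C)) (mapc h ` (C - {root C}))" by blast
  also have "mapc h (root C) = (1, snd (root C) + k)"
    using C_root(2) C_root(3)[OF C_root(1)] by (simp add: mapc_def outer_shift_def)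
  also have "mapc h ` (C - {root C}) = (\<lambda>(x, y). (x + k, y + k)) ` (C - {root C})"
    using C_root(3,4) by (intro image_cong) (force simp: mapc_def outer_shift_def split: prod.splits)+
  finally show ?thesis
    using C_facts by (simp add: ins_chord_def Let_def mapc_def inner_shift_def case_prod_unfold)
qed

lemma endpoints_disjoint_parts: "endpoints (mapc h ` C) \<inter> endpoints K = {}"
  using k by (auto simp: endpoints_mapc C_facts D_facts outer_shift_def inner_shift_def split: if_splits)

lemma endpoints_ins: "endpoints E = {1..2 * (n + m)}"
proof -
  have "endpoints E = h ` {1..2*n} \<union> H ` {1..2*m}"
    by (simp add: ins_chord_eq endpoints_Un endpoints_mapc C_facts D_facts)
  also have "\<dots> = {1..2 * (n + m)}"
  proof
    show "h ` {1..2*n} \<union> H ` {1..2*m} \<subseteq> {1..2 * (n + m)}"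
      using k C_facts(1) by (auto simp: outer_shift_def inner_shift_def)
    show "{1..2 * (n + m)} \<subseteq> h ` {1..2*n} \<union> H ` {1..2*m}"
    proof
      fix p assume p: "p \<in> {1..2 * (n + m)}"
      \<comment> \<open>The four ranges hold, in order, the left end of the root, the endpoints of
        \<open>D\<close> up to position \<open>k\<close>, the other endpoints of \<open>C\<close>,
        and the rest of \<open>D\<close>.\<close>
      consider "p = 1" | "1 < p" "p \<le> k + 1" | "k + 1 < p" "p \<le> k + 2 * n" | "k + 2 * n < p"
        using p by fastforce
      then show "p \<in> h ` {1..2*n} \<union> H ` {1..2*m}"
      proof cases
        case 1
        then have "p = h 1" "1 \<in> {1..2*n}" using C_facts(1) by (auto simp: outer_shift_def)
        then show ?thesis by blast
      next
        case 2
        then have "p = H (p - 1)" "p - 1 \<in> {1..2*m}" using k by (auto simp: inner_shift_def)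
        then show ?thesis by blast
      next
        case 3
        then have "p = h (p - k)" "p - k \<in> {1..2*n}" by (auto simp: outer_shift_def)
        then show ?thesis by blast
      next
        case 4
        then have "p = H (p - 2 * n)" "p - 2 * n \<in> {1..2*m}" using p by (auto simp: inner_shift_def)
        then show ?thesis by blast
      qed
    qed
  qed
  finally show ?thesis .
qed

lemma chord_system_ins: "chord_system E"
  unfolding ins_chord_eq
  by (intro chord_system_Un endpoints_disjoint_parts chord_system_mapc mono_h mono_H C_facts(2) D_facts(2))

lemma parts_disjoint: "mapc h ` C \<inter> K = {}"
  using endpoints_disjoint_parts endpointsI(1) by blast

lemma card_K: "card K = m"
  using card_image[OF inj_on_mapc[OF mono_H]] D_facts(3) by simp

lemma card_ins: "card E = n + m"
  unfolding ins_chord_eq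
  using card_Un_disjoint[OF _ _ parts_disjoint] C_facts D_facts card_K
    card_image[OF inj_on_mapc[OF mono_h]] by simp

lemma root_ins: "root E = mapc h (root C)"
proof (rule root_eqI[OF chord_system_ins])
  show "mapc h (root C) \<in> E" using ins_chord_eq C_root(1) by blast
  show "fst (mapc h (root C)) \<le> fst c" if "c \<in> E" for c
    using endpointsI(1)[OF that] endpoints_ins C_root(2) by (simp add: outer_shift_def)
qed

lemma snd_root_ins: "snd (root E) = snd (root C) + k"
  using root_ins C_root(3)[OF C_root(1)] by (simp add: outer_shift_def)

lemma ins_Diff_K: "E - K = mapc h ` C"
  unfolding ins_chord_eq using parts_disjoint by blast

lemma root_notin_K: "root E \<notin> K"
  using root_ins parts_disjoint C_root(1) by (metis disjoint_iff imageI)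

lemma ins_Diff_root_K: "E - {root E} - K = mapc h ` (C - {root C})"
proof -
  have "E - {root E} - K = (E - K) - {root E}" by blast
  also have "\<dots> = mapc h ` C - {mapc h (root C)}" unfolding ins_Diff_K root_ins ..
  also have "\<dots> = mapc h ` (C - {root C})"
    using inj_on_image_set_diff[of "mapc h" C C "{root C}", OF inj_on_mapc[OF mono_h]] C_root(1)
    by auto
  finally show ?thesis .
qed

text \<open>Both ends of a nonroot chord of \<open>C\<close> fall into the gap opened by
  \<open>inner_shift\<close>, where no chord of \<open>D\<close> has an endpoint.\<close>

lemma K_no_cross:
  assumes "x \<in> K" "y \<in> E - {root E} - K"
  shows "\<not> crosses x y"
proof -
  obtain c where c: "c \<in> C" "c \<noteq> root C" "y = mapc h c" using assms(2) ins_Diff_root_K by blast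
  obtain d where d: "d \<in> D" "x = mapc H d" using assms(1) by blast
  have "1 < fst c" "fst c \<le> 2 * n" "1 < snd c" "snd c \<le> 2 * n"
    using c C_root(3)[of c] C_root(4)[of c] endpointsI[OF c(1)] C_facts(4) by auto
  then show ?thesis
    unfolding crosses_def c(3) d(2) by (auto simp: outer_shift_def inner_shift_def)
qed

lemma connected_K: "connected_chords K"
  using connected_mapc[OF mono_H] D_facts(5) by blast

text \<open>The endpoint 2 witnesses that \<open>K\<close> is the first component; it is the image
  of 1 because \<open>k \<ge> 1\<close>.\<close>

lemma two_in_K: "2 \<in> endpoints K"
proof -
  have "1 \<in> endpoints D" "H 1 = 2" using D_facts(1,4) k by (auto simp: inner_shift_def)
  then show ?thesis unfolding endpoints_mapc by (metis imageI)
qed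

lemma two_less:
  assumes "q \<in> endpoints (E - {root E} - K)"
  shows "2 < q"
proof -
  obtain p where p: "p \<in> endpoints (C - {root C})" "q = h p"
    using assms unfolding ins_Diff_root_K endpoints_mapc by blast
  obtain c where c: "c \<in> C - {root C}" "p = fst c \<or> p = snd c" using endpointsE[OF p(1)] by blast
  then have "1 < p" using C_root(3)[of c] C_root(4)[of c] by auto
  then show ?thesis using p(2) k by (simp add: outer_shift_def)
qed

lemma connected_ins: "connected_chords E"
proof (rule connected_chords_via)
  fix c assume c: "c \<in> E"
  \<comment> \<open>The right end of the root of \<open>E\<close> lies in the gap after position
    \<open>k\<close>, so a chord of \<open>D\<close> straddling that position crosses the root and
    links the two parts.\<close>
  obtain d where d: "d \<in> D" "fst d \<le> k" "k < snd d"
    using connected_chords_straddle[OF D k(1)] k(2) D_facts(1) by fastforce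
  have "1 \<le> fst d" using endpointsI(1)[OF d(1)] D_facts(4) by simp
  moreover have "2 \<le> snd (root C)" "snd (root C) \<le> 2 * n" 
    using C_root(3)[OF C_root(1)] endpointsI(2)[OF C_root(1)] C_facts(4) by auto
  ultimately have cr: "crosses (root E) (mapc H d)"
    using d C_root(2) by (simp add: root_ins crosses_def outer_shift_def inner_shift_def)
  have sub: "K \<subseteq> E" "mapc h ` C \<subseteq> E" using ins_chord_eq by auto
  have rE: "root E \<in> mapc h ` C" using root_ins C_root(1) by simp
  have step: "(mapc H d, root E) \<in> cross_rel E"
    using cr d(1) sub rE crosses_sym by (auto simp: cross_rel_def)
  show "(c, root E) \<in> (cross_rel E)\<^sup>*"
  proof (cases "c \<in> K")
    case True
    then have "(c, mapc H d) \<in> (cross_rel K)\<^sup>*" 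
      using connected_K d(1) unfolding connected_chords_def by blast
    then show ?thesis using cross_path_mono[OF sub(1)] step by (meson rtrancl_into_rtrancl)
  next
    case False
    then have "c \<in> mapc h ` C" using c ins_Diff_K by blast
    then have "(c, root E) \<in> (cross_rel (mapc h ` C))\<^sup>*"
      using connected_mapc[OF mono_h] C_facts(5) rE unfolding connected_chords_def by blast
    then show ?thesis using cross_path_mono[OF sub(2)] by blast
  qed
qed

lemma rooted_connected_ins: "rooted_connected (n + m) E"
  unfolding rooted_connected_alt
  using C_facts(1) chord_system_ins card_ins endpoints_ins connected_ins by simp

lemma K_subset: "K \<subseteq> E - {root E}"
  using ins_chord_eq root_notin_K by blast

lemma first_comp_ins: "first_comp (E - {root E}) = K"
  by (rule first_comp_split[OF chord_system_ins K_subset connected_K K_no_cross two_in_K two_less])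

lemma norm_K: "norm K = D" "\<And>c. c \<in> D \<Longrightarrow> denorm K c = mapc H c"
  using norm_mapc[OF D_facts(4) mono_H] by auto

lemma norm_rest: "norm (E - K) = C" "\<And>c. c \<in> C \<Longrightarrow> denorm (E - K) c = mapc h c"
  unfolding ins_Diff_K using norm_mapc[OF C_facts(4) mono_h] by auto

text \<open>The right end of the root of \<open>E\<close> is that of the root of \<open>C\<close>
  plus the position, so only one position is possible.\<close>

lemma the_position: "(THE i. 1 \<le> i \<and> i \<le> 2 * card D - 1 \<and> E = ins_chord C i D) = k"
proof (rule the_equality)
  show "1 \<le> k \<and> k \<le> 2 * card D - 1 \<and> E = E" using k D_facts(3) by simp
  fix i assume i: "1 \<le> i \<and> i \<le> 2 * card D - 1 \<and> E = ins_chord C i D"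
  interpret I: insertion n m i C D
    using C D i D_facts(3) by unfold_locales auto
  show "i = k" using I.snd_root_ins snd_root_ins i by simp
qed

lemma label_inner:
  assumes "c \<in> D"
  shows "label E (mapc H c) = Suc (label D c)"
  using label_first_comp[OF chord_system_ins K_subset connected_K K_no_cross two_in_K two_less]
    label_mapc[OF D_facts(2) mono_H assms] assms by simp

lemma label_outer:
  assumes "c \<in> C"
  shows "label E (mapc h c) = (if c = root C then 1 else m + label C c)"
proof -
  have "mapc h c \<in> E - K" using assms ins_Diff_K by simp
  from label_rest[OF chord_system_ins K_subset connected_K K_no_cross two_in_K two_less this]
  show ?thesis
    unfolding ins_Diff_K card_K root_ins label_mapc[OF C_facts(2) mono_h assms]
    using inj_on_eq_iff[OF inj_on_mapc[OF mono_h] assms C_root(1)] by simp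
qed

end

section \<open>Existence of the decomposition and induction along it\<close>

section \<open>Root share decomposition\<close>

lemma card_endpoints:
  assumes "chord_system S"
  shows "card (endpoints S) = 2 * card S"
proof -
  have "inj_on fst S" "inj_on snd S"
    using chord_system_disjoint[OF assms] by (meson inj_onI)+
  moreover have "fst ` S \<inter> snd ` S = {}"
  proof -
    have "fst c \<noteq> snd c'" if "c \<in> S" "c' \<in> S" for c c'
      using chord_system_disjoint(2)[OF assms that] chord_system_less[OF assms that(1)] by fastforce
    then show ?thesis by blast
  qed
  ultimately show ?thesis
    using chord_system_finite[OF assms] by (simp add: endpoints_def card_Un_disjoint card_image)
qed

lemma strict_mono_rank:
  assumes "finite A"
  shows "strict_mono_on A (rank A)"
proof (rule strict_mono_onI)
  fix p q assume "p \<in> A" "q \<in> A" "p < q"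
  then have "{x \<in> A. x < p} \<subset> {x \<in> A. x < q}" by auto
  then show "rank A p < rank A q" using assms by (simp add: rank_def psubset_card_mono)
qed

lemma rank_image:
  assumes "finite A"
  shows "rank A ` A = {1..card A}"
proof (rule card_subset_eq)
  have "rank A p \<in> {1..card A}" if p: "p \<in> A" for p
  proof -
    have "{x \<in> A. x < p} \<subset> A" using p by auto
    then show ?thesis using assms by (simp add: rank_def psubset_card_mono Suc_le_eq)
  qed
  then show "rank A ` A \<subseteq> {1..card A}" by blast
  show "card (rank A ` A) = card {1..card A}"
    using card_image[OF strict_mono_on_imp_inj_on[OF strict_mono_rank[OF assms]]] by simp
qed simp

lemma norm_eq_mapc: "norm S = mapc (rank (endpoints S)) ` S"
  by (simp add: norm_def norm_chord_def mapc_def)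

lemma rooted_connected_norm:
  assumes "chord_system S" "S \<noteq> {}" "connected_chords S"
  shows "rooted_connected (card S) (norm S)"
proof -
  have fin: "finite S" "finite (endpoints S)"
    using assms(1) chord_system_finite finite_endpoints by blast+
  note mono = strict_mono_rank[OF fin(2)]
  have "chord_system (norm S)" "card (norm S) = card S" "connected_chords (norm S)"
    unfolding norm_eq_mapc using chord_system_mapc[OF assms(1) mono]
      card_image[OF inj_on_mapc[OF mono]] connected_mapc[OF mono] assms(3) by simp_all
  moreover have "endpoints (norm S) = {1..2 * card S}"
    unfolding norm_eq_mapc endpoints_mapc rank_image[OF fin(2)] card_endpoints[OF assms(1)] ..
  moreover have "1 \<le> card S" using fin assms(2) by (simp add: Suc_le_eq card_gt_0_iff)
  ultimately show ?thesis unfolding rooted_connected_alt by simp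
qed

text \<open>A chord with both ends outside the interval of \<open>c'\<close> cannot cross one lying
  inside it. As \<open>c0\<close> starts left of \<open>c'\<close> and nothing in \<open>K\<close>
  crosses \<open>c'\<close>, being outside propagates along crossing paths from \<open>c0\<close> to
  all of \<open>K\<close>.\<close>

lemma chords_outside:
  assumes conn: "connected_chords K" and c0: "c0 \<in> K" "fst c0 < fst c'"
    and nc: "\<And>c. c \<in> K \<Longrightarrow> \<not> crosses c c'"
    and dis: "\<And>q. q \<in> endpoints K \<Longrightarrow> q \<noteq> fst c' \<and> q \<noteq> snd c'"
    and less: "fst c' < snd c'"
    and q: "q \<in> endpoints K"
  shows "q < fst c' \<longleftrightarrow> q < snd c'"
proof -
  have out: "(fst c < fst c' \<longleftrightarrow> fst c < snd c') \<and> (snd c < fst c' \<longleftrightarrow> snd c < snd c')"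
    if "(c0, c) \<in> (cross_rel K)\<^sup>*" for c
    using that
  proof (induction rule: rtrancl_induct)
    case base
    have "\<not> crosses c0 c'" "snd c0 \<noteq> fst c'" "snd c0 \<noteq> snd c'"
      using nc dis endpointsI c0 by auto
    then show ?case using c0(2) less by (auto simp: crosses_def)
  next
    case (step y z)
    have yz: "y \<in> K" "z \<in> K" "crosses y z" using step.hyps(2) by (auto simp: cross_rel_def)
    have z: "\<not> crosses z c'" "fst z \<noteq> fst c'" "snd z \<noteq> snd c'" "snd z \<noteq> fst c'" "fst z \<noteq> snd c'"
      using nc dis endpointsI yz(2) by auto
    show ?case using step.IH yz(3) z less unfolding crosses_def by linarith
  qed
  obtain c where c: "c \<in> K" "q = fst c \<or> q = snd c" using endpointsE[OF q] by blast
  have "(c0, c) \<in> (cross_rel K)\<^sup>*" using conn c0(1) c(1) by (simp add: connected_chords_def)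
  from out[OF this] c(2) show ?thesis by auto
qed

text \<open>Take for \<open>K\<close> the component of nonroot chords through the endpoint 2. All
  endpoints of the remaining chords except 1 lie in a single gap between endpoints of
  \<open>K\<close>, the one around the right end of the root. Then \<open>k\<close> counts the
  endpoints of \<open>K\<close> before this gap, and the two shifts undo the ranks used by
  \<open>norm\<close>.\<close>

lemma rooted_connected_decomp:
  assumes E: "rooted_connected N E" and N: "N \<ge> 2"
  obtains n m k C D where "insertion n m k C D" "E = ins_chord C k D"
proof -
  note E' = rooted_connectedD[OF E]
  define r where "r = root E"
  note r = rooted_connected_root[OF E, folded r_def]
  have less: "fst c < snd c" if "c \<in> E" for c using chord_system_less[OF E'(2) that] .
  have reach: "(c, c') \<in> (cross_rel E)\<^sup>*" if "c \<in> E" "c' \<in> E" for c c'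
    using E'(5) that by (simp add: connected_chords_def)

  have cross_root: "1 < fst c \<and> fst c < snd r \<and> snd r < snd c"
    if "c \<in> E" "c \<noteq> r" "crosses c r" for c
    using that(3) r(2) r(4)[OF that(1,2)] by (auto simp: crosses_def)
  have "\<exists>y\<in>E - {r}. crosses y r"
  proof (rule ccontr)
    assume no: "\<not> ?thesis"
    have "E \<noteq> {r}" using E'(3) N by auto
    then obtain c where c: "c \<in> E" "c \<noteq> r" using r(1) by auto
    have "\<not> crosses x y" if "x \<in> {r}" "y \<in> E - {r}" for x y
      using that no crosses_sym[of r] by auto
    from cross_path_closed[where K = "{r}", OF reach[OF r(1) c(1)] _ this] c(2) show False by simp
  qed
  \<comment> \<open>A chord crossing the root starts strictly between 1 and \<open>snd r\<close>. So
    2 is not an end of the root and belongs to a nonroot chord.\<close>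
  then have r_gt: "2 < snd r" using cross_root by fastforce

  have "2 \<in> endpoints E" using E'(4) N by simp
  then obtain c0 where c0: "c0 \<in> E" "2 = fst c0 \<or> 2 = snd c0" using endpointsE by blast
  have c0r: "c0 \<noteq> r" using c0 r(2) r_gt by auto
  have fst_c0: "fst c0 = 2" using c0(2) r(4)[OF c0(1) c0r] less[OF c0(1)] by auto
  define K where "K = comp (E - {r}) c0"
  define S where "S = E - K"
  have c0K: "c0 \<in> K" using comp_self c0(1) c0r by (simp add: K_def)
  have KE: "K \<subseteq> E - {r}" using comp_subset by (simp add: K_def)
  have nc: "\<not> crosses x y" if "x \<in> K" "y \<in> E - {r} - K" for x y
    using comp_no_cross that by (simp add: K_def)
  have connK: "connected_chords K" using connected_comp c0(1) c0r by (simp add: K_def)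
  have rS: "r \<in> S" using r(1) KE by (auto simp: S_def)
  have SE: "S \<subseteq> E" "S \<inter> K = {}" "S \<union> K = E" using KE by (auto simp: S_def)
  have csK: "chord_system K" and csS: "chord_system S"
    using chord_system_subset[OF E'(2)] KE SE by auto
  define e where "e = endpoints S"
  define f where "f = endpoints K"
  have ef: "e \<inter> f = {}" "e \<union> f = {1..2*N}"
    using endpoints_disjoint[OF E'(2)] SE KE E'(4) endpoints_Un[of S K]
    by (auto simp: e_def f_def)
  have fin: "finite e" "finite f"
    using finite_endpoints chord_system_finite csK csS by (auto simp: e_def f_def)
  have two: "2 \<in> f" using endpointsI(1)[OF c0K] fst_c0 by (simp add: f_def)

  \<comment> \<open>The right end of \<open>z\<close> is an endpoint of \<open>K\<close> beyond
    \<open>snd r\<close>; it gives the bound \<open>k \<le> 2 * m - 1\<close>.\<close>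
  obtain z where z: "z \<in> K" "fst z < snd r" "snd r < snd z"
  proof -
    have "\<exists>z\<in>K. crosses z r"
    proof (rule ccontr)
      assume "\<not> ?thesis"
      then have "\<not> crosses x y" if "x \<in> K" "y \<in> E - K" for x y
        using nc that by blast
      from cross_path_closed[OF reach[OF c0(1) r(1)] c0K this] KE show False by auto
    qed
    then obtain z where "z \<in> K" "crosses z r" by blast
    moreover then have "z \<in> E" "z \<noteq> r" using KE by auto
    ultimately show ?thesis using that cross_root by blast
  qed

  \<comment> \<open>Cut at its first visit to the root, a path from \<open>S\<close> to the root
    avoids \<open>K\<close>, since nonroot chords of \<open>S\<close> cross no chord of
    \<open>K\<close>.\<close>
  have S_reach: "c \<in> S \<longrightarrow> (c, r) \<in> (cross_rel S)\<^sup>*" if "(c, r) \<in> (cross_rel E)\<^sup>*" for c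
    using that
  proof (induction rule: converse_rtrancl_induct)
    case base
    then show ?case by simp
  next
    case (step y z)
    show ?case
    proof
      assume y: "y \<in> S"
      have yz: "z \<in> E" "crosses y z" using step.hyps(1) by (auto simp: cross_rel_def)
      show "(y, r) \<in> (cross_rel S)\<^sup>*"
      proof (cases "y = r")
        case False
        then have "z \<in> S" using nc[of z y] yz y crosses_sym[of y z] by (auto simp: S_def)
        then have "(y, z) \<in> cross_rel S" using y yz by (simp add: cross_rel_def)
        then show ?thesis using step.IH \<open>z \<in> S\<close> by (meson converse_rtrancl_into_rtrancl)
      qed simp
    qed
  qed
  have connS: "connected_chords S"
    using connected_chords_via[of S r] S_reach reach r(1) SE(1) by blast

  have gap: "q < fst c \<longleftrightarrow> q < snd c" if c: "c \<in> S" "c \<noteq> r" and q: "q \<in> f" for c q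
  proof (rule chords_outside[OF connK c0K])
    have cE: "c \<in> E" "c \<in> E - {r} - K" using c SE by auto
    have "fst c \<in> e" "snd c \<in> e" using endpointsI[OF c(1)] by (simp_all add: e_def)
    then show d: "x \<noteq> fst c \<and> x \<noteq> snd c" if "x \<in> endpoints K" for x
      using that ef(1) by (auto simp: f_def)
    have "fst c \<noteq> 2" using d[of 2] two by (simp add: f_def)
    then show "fst c0 < fst c" using fst_c0 r(4)[OF cE(1) c(2)] by simp
    show "\<not> crosses x c" if "x \<in> K" for x using nc[OF that cE(2)] .
    show "fst c < snd c" using less[OF cE(1)] .
    show "q \<in> endpoints K" using q by (simp add: f_def)
  qed
  \<comment> \<open>Walking along crossings from \<open>r\<close>, consecutive intervals overlap,
    and by \<open>gap\<close> the point \<open>q\<close> lies inside no nonroot chord of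
    \<open>S\<close>. So all ends other than 1 stay on the same side of \<open>q\<close> as
    \<open>snd r\<close>.\<close>
  have split: "(c \<noteq> r \<longrightarrow> (q < fst c \<longleftrightarrow> q < snd r)) \<and> (q < snd c \<longleftrightarrow> q < snd r)"
    if "c \<in> S" "q \<in> f" for c q
  proof -
    have "(r, c) \<in> (cross_rel S)\<^sup>*" using connS rS that(1) by (simp add: connected_chords_def)
    then show ?thesis
    proof (induction rule: rtrancl_induct)
      case base
      then show ?case by simp
    next
      case (step y z)
      have yz: "y \<in> S" "z \<in> S" "crosses y z" using step.hyps(2) by (auto simp: cross_rel_def)
      show ?case
      proof (cases "z = r")
        case False
        note gz = gap[OF yz(2) False that(2)]
        show ?thesis
        proof (cases "y = r")
          case True
          then have "fst z < snd r \<and> snd r < snd z"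
            using cross_root[of z] yz False SE(1) crosses_sym[of z] by auto
          then show ?thesis using gz by linarith
        next
          case False
          then show ?thesis using step.IH gz yz(3) unfolding crosses_def by linarith
        qed
      qed simp
    qed
  qed
  have split': "q < p \<longleftrightarrow> q < snd r" if p: "p \<in> e" "p \<noteq> 1" "q \<in> f" for p q
  proof -
    obtain c where c: "c \<in> S" "p = fst c \<or> p = snd c" using endpointsE p(1) e_def by blast
    then show ?thesis using split[OF c(1) p(3)] p(2) r(2) by auto
  qed

  define k where "k = card {q \<in> f. q < snd r}"
  define n where "n = card S"
  define m where "m = card K"
  have C: "rooted_connected n (norm S)"
    using rooted_connected_norm[OF csS _ connS] rS by (auto simp: n_def)
  have D: "rooted_connected m (norm K)"
    using rooted_connected_norm[OF csK _ connK] c0K by (auto simp: m_def)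
  have card_ef: "card e = 2 * n" "card f = 2 * m"
    using card_endpoints csS csK by (simp_all add: e_def f_def n_def m_def)
  have k1: "1 \<le> k"
  proof -
    have "2 \<in> {q \<in> f. q < snd r}" using two r_gt by simp
    then show ?thesis using fin by (auto simp: k_def Suc_le_eq card_gt_0_iff)
  qed
  have k2: "k \<le> 2 * m - 1"
  proof -
    have sz: "snd z \<in> f" using endpointsI(2)[OF z(1)] by (simp add: f_def)
    have "q \<noteq> snd z" if "q < snd r" for q using that z(3) by linarith
    then have "{q \<in> f. q < snd r} \<subseteq> f - {snd z}" by blast
    from card_mono[OF _ this] show ?thesis
      using fin(2) card_Diff_singleton[OF sz] card_ef(2) by (simp add: k_def)
  qed
  interpret I: insertion n m k "norm S" "norm K"
    using C D k1 k2 by unfold_locales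

  \<comment> \<open>Positions below \<open>p\<close> are shared between \<open>e\<close> and
    \<open>f\<close>, so a rank in one set follows from a count in the other.\<close>
  have count: "card {q \<in> e. q < p} + card {q \<in> f. q < p} = p - 1" if "p \<in> {1..2*N}" for p
  proof -
    have "{q \<in> e. q < p} \<union> {q \<in> f. q < p} = {q \<in> e \<union> f. q < p}" by blast
    also have "\<dots> = {1..<p}" unfolding ef(2) using that by auto
    finally have "{q \<in> e. q < p} \<union> {q \<in> f. q < p} = {1..<p}" .
    moreover have "{q \<in> e. q < p} \<inter> {q \<in> f. q < p} = {}" using ef(1) by blast
    ultimately show ?thesis using fin card_Un_disjoint[of "{q \<in> e. q < p}" "{q \<in> f. q < p}"] by simp
  qed
  have one: "1 \<in> e" using endpointsI(1)[OF rS] r(2) by (simp add: e_def)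
  have pos: "1 \<le> p" "p \<le> 2 * N" if "p \<in> e \<union> f" for p using that ef(2) by auto
  \<comment> \<open>Below an endpoint of \<open>S\<close> other than 1 lie exactly \<open>k\<close>
    endpoints of \<open>K\<close>.\<close>
  have outer: "I.h (rank e p) = p" if p: "p \<in> e" for p
  proof (cases "p = 1")
    case True
    have "{q \<in> e. q < 1} = {}" using pos by force
    then show ?thesis using True unfolding outer_shift_def rank_def by simp
  next
    case False
    have "{q \<in> f. q < p} = {q \<in> f. q < snd r}" using split'[OF p False] by auto
    then have "card {q \<in> e. q < p} + k = p - 1" using count[of p] pos[of p] p by (simp add: k_def)
    moreover have "1 \<in> {q \<in> e. q < p}" using one pos[of p] p False by simp
    then have "card {q \<in> e. q < p} > 0" using fin by (auto simp: card_gt_0_iff)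
    ultimately have "1 < rank e p" "rank e p + k = p" unfolding rank_def by linarith+
    then show ?thesis by (simp add: outer_shift_def)
  qed
  \<comment> \<open>An endpoint of \<open>K\<close> before \<open>snd r\<close> has only 1 from
    \<open>e\<close> below it; one after \<open>snd r\<close> has all \<open>2 * n\<close> elements
    of \<open>e\<close> below it.\<close>
  have inner: "I.H (rank f q) = q" if q: "q \<in> f" for q
  proof (cases "q < snd r")
    case True
    have "{p \<in> e. p < q} \<subseteq> {1}" using split'[OF _ _ q] True by fastforce
    moreover have "1 \<in> {p \<in> e. p < q}" using one q ef(1) pos[of q] by (auto simp: le_less)
    ultimately have "{p \<in> e. p < q} = {1}" by blast
    then have "card {x \<in> f. x < q} + 1 = q - 1" using count[of q] pos[of q] q by simp
    moreover have "card {x \<in> f. x < q} < k"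
      unfolding k_def using True q fin(2) by (intro psubset_card_mono) auto
    ultimately have "rank f q \<le> k" "rank f q + 1 = q" unfolding rank_def by linarith+
    then show ?thesis by (simp add: inner_shift_def)
  next
    case False
    have "snd r \<in> e" using endpointsI(2)[OF rS] by (simp add: e_def)
    then have "snd r < q" using False q ef(1) by (metis disjoint_iff linorder_neqE_nat)
    have "p < q" if p: "p \<in> e" for p
    proof (cases "p = 1")
      case True
      then show ?thesis using pos[of q] q one ef(1) by (metis UnI2 disjoint_iff le_neq_implies_less)
    next
      case F: False
      then have "\<not> q < p" using split'[OF p F q] False by simp
      moreover have "p \<noteq> q" using p q ef(1) by blast
      ultimately show ?thesis by simp
    qed
    then have "{p \<in> e. p < q} = e" by blast
    then have "2 * n + card {x \<in> f. x < q} = q - 1" using count[of q] pos[of q] q card_ef by simp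
    moreover have "k \<le> card {x \<in> f. x < q}"
      unfolding k_def using \<open>snd r < q\<close> fin(2) by (intro card_mono) auto
    ultimately have "k < rank f q" "rank f q + 2 * n = q" using pos[of q] q unfolding rank_def by auto
    then show ?thesis by (simp add: inner_shift_def)
  qed
  have "mapc I.h ` norm S = (\<lambda>c. c) ` S"
    unfolding norm_eq_mapc image_image
    by (intro image_cong refl) (simp add: mapc_def outer[unfolded e_def] endpointsI)
  moreover have "mapc I.H ` norm K = (\<lambda>c. c) ` K"
    unfolding norm_eq_mapc image_image
    by (intro image_cong refl) (simp add: mapc_def inner[unfolded f_def] endpointsI)
  ultimately have "E = ins_chord (norm S) k (norm K)"
    unfolding I.ins_chord_eq using SE(3) by simp
  then show ?thesis using that I.insertion_axioms by blast
qed

text \<open>Each part of the decomposition has at least one chord, so both are smaller than the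
  whole.\<close>

lemma rooted_connected_induct [consumes 1, case_names single insertion]:
  assumes "rooted_connected N E"
    and single: "\<And>C. rooted_connected 1 C \<Longrightarrow> P 1 C"
    and ins: "\<And>n m k C D. insertion n m k C D \<Longrightarrow> P n C \<Longrightarrow> P m D \<Longrightarrow> P (n + m) (ins_chord C k D)"
  shows "P N E"
  using assms(1)
proof (induction N arbitrary: E rule: less_induct)
  case (less N)
  note E' = rooted_connectedD[OF less.prems]
  show ?case
  proof (cases "N = 1")
    case True
    then show ?thesis using single less.prems by simp
  next
    case False
    then have "N \<ge> 2" using E'(1) by simp
    then obtain n m k C D where I: "insertion n m k C D" "E = ins_chord C k D"
      using rooted_connected_decomp[OF less.prems] by blast
    interpret insertion n m k C D by (rule I(1))
    have "N = n + m" using card_ins E'(3) I(2) by simp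
    moreover then have "n < N" "m < N" using C_facts(1) D_facts(1) by auto
    ultimately show ?thesis using ins[OF I(1)] less.IH C D I(2) by simp
  qed
qed

section \<open>Labels, terminal labels and base chord of an insertion\<close>

section \<open>Labels and terminal chords of an insertion\<close>

lemma rooted_connected_1:
  assumes "rooted_connected 1 C"
  shows "C = {root C}"
  using rooted_connectedD(3)[OF assms] rooted_connected_root(1)[OF assms] 
  by (metis card_1_singletonE singletonD)

context insertion
begin

text \<open>Nonroot labels of \<open>C\<close> jump over the block \<open>2, ..., m + 1\<close>
  occupied by \<open>D\<close>.\<close>

definition outer_label :: "nat \<Rightarrow> nat" where
  "outer_label l = (if l = 1 then 1 else m + l)"

lemma label_outer':
  assumes "inj_on (label C) C" "c \<in> C"
  shows "label E (mapc h c) = outer_label (label C c)"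
proof -
  have "label C c = 1 \<longleftrightarrow> c = root C"
    using inj_on_eq_iff[OF assms C_root(1)] label_root[of "root C" C] by simp
  then show ?thesis using label_outer[OF assms(2)] by (auto simp: outer_label_def)
qed

end

lemma label_bij:
  assumes "rooted_connected N X"
  shows "bij_betw (label X) X {1..N}"
  using assms
proof (induction rule: rooted_connected_induct)
  case (single C)
  obtain c where c: "C = {c}" "root C = c" using rooted_connected_1[OF single] by blast
  then have "label C c = 1" using label_root[of c C] by simp
  then show ?case using c(1) by (simp add: bij_betw_def)
next
  case (insertion n m k C D)
  interpret insertion n m k C D by (rule insertion)
  have C': "inj_on (label C) C" "label C ` C = {1..n}" and D': "label D ` D = {1..m}"
    using insertion by (auto simp: bij_betw_def)
  have "label E ` mapc h ` C = outer_label ` {1..n}"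
    unfolding image_image C'(2)[symmetric] using label_outer'[OF C'(1)] by (intro image_cong) auto
  also have "\<dots> = insert 1 {m + 2..m + n}"
  proof -
    have "{1..n} = insert 1 {2..n}" using C_facts(1) by auto
    then have "outer_label ` {1..n} = insert (outer_label 1) (outer_label ` {2..n})"
      by (simp only: image_insert)
    also have "outer_label 1 = 1" by (simp add: outer_label_def)
    also have "outer_label ` {2..n} = (+) m ` {2..n}" by (intro image_cong) (auto simp: outer_label_def)
    finally show ?thesis by (simp add: add.commute)
  qed
  finally have 1: "label E ` mapc h ` C = insert 1 {m + 2..m + n}" .
  have "label E ` K = Suc ` {1..m}"
    unfolding image_image D'[symmetric] using label_inner by (intro image_cong) auto
  then have 2: "label E ` K = {2..m + 1}" by (simp add: numeral_2_eq_2)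
  have "label E ` E = label E ` mapc h ` C \<union> label E ` K"
    unfolding ins_chord_eq image_Un ..
  also have "\<dots> = {1..n + m}" unfolding 1 2 using C_facts(1) D_facts(1) by auto
  finally have img: "label E ` E = {1..n + m}" .
  \<comment> \<open>Injectivity comes from counting: the image has as many elements as
    \<open>E\<close>.\<close>
  moreover have "inj_on (label E) E"
    using img card_ins chord_system_finite[OF chord_system_ins] by (intro eq_card_imp_inj_on) auto
  ultimately show ?case by (simp add: bij_betw_def)
qed

lemma term_labels_subset: "rooted_connected n C \<Longrightarrow> term_labels C \<subseteq> {1..n}"
  using label_bij[of n C] unfolding term_labels_def bij_betw_def by blast

text \<open>No later chord is left to be crossed. The fact makes \<open>Min\<close> of the terminal
  labels meaningful and locates the end of the terminal labels of \<open>D\<close> in an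
  insertion.\<close>

lemma last_term_label:
  assumes "rooted_connected n C"
  shows "n \<in> term_labels C"
proof -
  note b = label_bij[OF assms] and n = rooted_connectedD(1)[OF assms]
  obtain c where c: "c \<in> C" "label C c = n"
    using b n unfolding bij_betw_def by (metis atLeastAtMost_iff image_iff order_refl)
  have "label C c' \<le> n" if "c' \<in> C" for c'
    using b that unfolding bij_betw_def by auto
  then have "terminal C c" using c(2) by (auto simp: terminal_def not_less)
  then show ?thesis using c unfolding term_labels_def by blast
qed

lemma base_in:
  assumes "rooted_connected n C"
  shows "base C \<in> {1..n}"
  using Min_in[of "term_labels C"] term_labels_subset[OF assms] last_term_label[OF assms]
    finite_subset[OF term_labels_subset[OF assms]] unfolding base_def by blast

context insertion
begin

lemma ex_crosses_root: "\<exists>x\<in>K. crosses (root E) x"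
proof (rule ccontr)
  assume no: "\<not> ?thesis"
  have r: "root E \<in> E - K" using root_notin_K root_props(1)[OF chord_system_ins] 
    rooted_connectedD(6)[OF rooted_connected_ins] by blast
  obtain x where x: "x \<in> K" using D_facts(6) by blast
  have "\<not> crosses y z" if "y \<in> K" "z \<in> E - K" for y z
    using K_no_cross[of y z] no that crosses_sym[of y z] by blast
  moreover have "(x, root E) \<in> (cross_rel E)\<^sup>*"
    using connected_ins r x K_subset unfolding connected_chords_def by blast
  ultimately have "root E \<in> K" using cross_path_closed[of x "root E" E K] x by blast
  then show False using r by blast
qed

lemma label_outer_inj: "c \<in> C \<Longrightarrow> label E (mapc h c) = outer_label (label C c)"
  using label_outer'[OF bij_betw_imp_inj_on[OF label_bij[OF C]]] .

lemma label_pos: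
  assumes "c \<in> C" shows "1 \<le> label C c"
  using bij_betwE[OF label_bij[OF C]] assms by simp

lemma label_pos_D:
  assumes "c \<in> D" shows "1 \<le> label D c"
  using bij_betwE[OF label_bij[OF D]] assms by simp

lemma label_root_ins: "label E (root E) = 1"
  by (rule label_root) simp

lemma root_not_terminal: "\<not> terminal E (root E)"
proof -
  obtain d where d: "d \<in> D" "crosses (root E) (mapc H d)" using ex_crosses_root by blast
  have "label E (root E) < label E (mapc H d)"
    using label_root_ins label_inner[OF d(1)] label_pos_D[OF d(1)] by simp
  moreover have "mapc H d \<in> E" using d(1) ins_chord_eq by blast
  ultimately show ?thesis using d(2) unfolding terminal_def by blast
qed

text \<open>Outside \<open>K\<close> only the root can cross a chord of \<open>K\<close>, and its
  label 1 is never the larger one.\<close>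

lemma terminal_inner:
  assumes "d \<in> D"
  shows "terminal E (mapc H d) \<longleftrightarrow> terminal D d"
proof -
  have "(\<exists>c'\<in>E. label E (mapc H d) < label E c' \<and> crosses (mapc H d) c') \<longleftrightarrow>
        (\<exists>c'\<in>K. label E (mapc H d) < label E c' \<and> crosses (mapc H d) c')" (is "?l \<longleftrightarrow> ?r")
  proof
    assume ?l
    then obtain c' where c': "c' \<in> E" "label E (mapc H d) < label E c'" "crosses (mapc H d) c'" by blast
    have "c' \<noteq> root E" using c'(2) label_root_ins label_inner[OF assms] by auto
    then have "c' \<in> K" using K_no_cross[of "mapc H d" c'] c' assms by blast
    then show ?r using c' by blast
  next
    assume ?r
    then show ?l using K_subset by blast
  qed
  also have "\<dots> \<longleftrightarrow> (\<exists>d'\<in>D. label D d < label D d' \<and> crosses d d')"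
    using label_inner assms crosses_mapc[OF mono_H assms] by simp
  finally show ?thesis by (simp add: terminal_def)
qed

text \<open>A nonroot chord of \<open>C\<close> crosses nothing in \<open>K\<close>, and the
  renumbering preserves the order of the labels of \<open>C\<close>.\<close>

lemma terminal_outer:
  assumes "c \<in> C" "c \<noteq> root C"
  shows "terminal E (mapc h c) \<longleftrightarrow> terminal C c"
proof -
  have hc: "mapc h c \<in> E - {root E} - K" using assms ins_Diff_root_K by blast
  have "(\<exists>c'\<in>E. label E (mapc h c) < label E c' \<and> crosses (mapc h c) c') \<longleftrightarrow>
        (\<exists>c'\<in>mapc h ` C. label E (mapc h c) < label E c' \<and> crosses (mapc h c) c')" (is "?l \<longleftrightarrow> ?r")
  proof
    assume ?l
    then obtain c' where c': "c' \<in> E" "label E (mapc h c) < label E c'" "crosses (mapc h c) c'" by blast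
    have "c' \<notin> K" using K_no_cross[OF _ hc, of c'] c'(3) crosses_sym[of c'] by blast
    then have "c' \<in> mapc h ` C" using ins_Diff_K c'(1) by blast
    then show ?r using c' by blast
  next
    assume ?r
    then show ?l using ins_chord_eq by blast
  qed
  also have "\<dots> \<longleftrightarrow> (\<exists>c'\<in>C. label E (mapc h c) < label E (mapc h c') \<and> crosses c c')"
    using crosses_mapc[OF mono_h assms(1)] by simp
  also have "\<dots> \<longleftrightarrow> (\<exists>c'\<in>C. label C c < label C c' \<and> crosses c c')"
  proof -
    have "label E (mapc h c) < label E (mapc h c') \<longleftrightarrow> label C c < label C c'" if "c' \<in> C" for c'
      using assms label_outer[OF assms(1)] label_outer[OF that] label_pos[OF assms(1)]
        label_root[of "root C" C] by auto
    then show ?thesis by blast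
  qed
  finally show ?thesis by (simp add: terminal_def)
qed

lemma label_eq_1: "c \<in> C \<Longrightarrow> label C c = 1 \<longleftrightarrow> c = root C"
  using inj_on_eq_iff[OF bij_betw_imp_inj_on[OF label_bij[OF C]] _ C_root(1), of c]
    label_root[of "root C" C] by simp

text \<open>The label 1 is removed because the root is never terminal in \<open>E\<close>, although
  it is terminal in \<open>C\<close> when \<open>n = 1\<close>.\<close>

lemma term_labels_ins:
  "term_labels E = Suc ` term_labels D \<union> (+) m ` (term_labels C - {1})"
proof -
  have "{c \<in> E. terminal E c} =
      mapc h ` {c \<in> C - {root C}. terminal C c} \<union> mapc H ` {d \<in> D. terminal D d}" (is "_ = ?A \<union> ?B")
  proof -
    have "{c \<in> E. terminal E c} = {c \<in> E - {root E} - K. terminal E c} \<union> {c \<in> K. terminal E c}"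
      using root_not_terminal ins_chord_eq by blast
    also have "{c \<in> E - {root E} - K. terminal E c} = ?A"
      unfolding ins_Diff_root_K using terminal_outer by blast
    also have "{c \<in> K. terminal E c} = ?B" using terminal_inner by blast
    finally show ?thesis .
  qed
  then have "term_labels E = label E ` ?A \<union> label E ` ?B"
    unfolding term_labels_def by (simp only: image_Un)
  also have "label E ` ?A = (+) m ` label C ` {c \<in> C - {root C}. terminal C c}"
    unfolding image_image using label_outer by (intro image_cong) auto
  also have "label C ` {c \<in> C - {root C}. terminal C c} = term_labels C - {1}"
    unfolding term_labels_def using label_eq_1 by fastforce
  also have "label E ` ?B = Suc ` term_labels D"
    unfolding image_image term_labels_def using label_inner by (intro image_cong) auto
  finally show ?thesis by (simp add: Un_commute)
qed

lemma one_notin_term_labels_ins: "1 \<notin> term_labels E"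
proof -
  have "0 \<notin> term_labels D" "0 \<notin> term_labels C"
    using term_labels_subset[OF D] term_labels_subset[OF C] by auto
  then show ?thesis unfolding term_labels_ins using D_facts(1) by auto
qed

text \<open>\<open>D\<close> has a terminal label, at most \<open>m\<close>, while the terminal
  labels coming from \<open>C\<close> all exceed \<open>m + 1\<close>. The base chord is therefore
  that of \<open>D\<close>.\<close>

lemma base_ins: "base E = Suc (base D)"
proof -
  have T: "finite (term_labels D)" "m \<in> term_labels D" "finite (term_labels C)"
    using term_labels_subset[OF D] term_labels_subset[OF C] last_term_label[OF D]
      finite_subset by blast+
  have "Min (term_labels E) = Suc (Min (term_labels D))"
    unfolding term_labels_ins
  proof (rule Min_eqI)
    show "Suc (Min (term_labels D)) \<le> y" if "y \<in> Suc ` term_labels D \<union> (+) m ` (term_labels C - {1})" for y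
      using that
    proof
      assume "y \<in> Suc ` term_labels D"
      then show ?thesis using T by auto
    next
      assume "y \<in> (+) m ` (term_labels C - {1})"
      then obtain t where "t \<in> term_labels C" "y = m + t" by blast
      moreover have "Min (term_labels D) \<le> m" using T by simp
      ultimately show ?thesis using term_labels_subset[OF C] by fastforce
    qed
    show "Suc (Min (term_labels D)) \<in> Suc ` term_labels D \<union> (+) m ` (term_labels C - {1})"
      using Min_in[OF T(1)] T(2) by blast
  qed (use T in auto)
  then show ?thesis by (simp add: base_def)
qed

end

lemma one_notin_term_labels:
  assumes "rooted_connected n C" "n \<noteq> 1"
  shows "1 \<notin> term_labels C"
proof -
  have "n \<ge> 2" using rooted_connectedD(1)[OF assms(1)] assms(2) by simp
  then obtain n' m k C' D where "insertion n' m k C' D" "C = ins_chord C' k D"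
    using rooted_connected_decomp[OF assms(1)] by blast
  then show ?thesis using insertion.one_notin_term_labels_ins by blast
qed

section \<open>Grafting, branch-left counts and the weight recurrence\<close>

section \<open>Weights of insertion trees\<close>

text \<open>The parts of an insertion tree carry labels of the ambient diagram; relabelling compares
  them with the insertion trees of the parts themselves.\<close>

fun relabel :: "(nat \<Rightarrow> nat) \<Rightarrow> itree \<Rightarrow> itree" where
  "relabel g (Leaf l) = Leaf (g l)"
| "relabel g (Node L R) = Node (relabel g L) (relabel g R)"

fun leaves :: "itree \<Rightarrow> nat set" where
  "leaves (Leaf l) = {l}"
| "leaves (Node L R) = leaves L \<union> leaves R"

fun leaf_distinct :: "itree \<Rightarrow> bool" where
  "leaf_distinct (Leaf l) = True"
| "leaf_distinct (Node L R) \<longleftrightarrow> leaf_distinct L \<and> leaf_distinct R \<and> leaves L \<inter> leaves R = {}"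

text \<open>As in \<^const>\<open>nu_pairs\<close>, the last argument is the branch-left count inherited by the root.\<close>

fun tree_weight :: "(nat \<Rightarrow> nat \<Rightarrow> 'a::comm_ring_1) \<Rightarrow> itree \<Rightarrow> nat \<Rightarrow> 'a" where
  "tree_weight w (Leaf l) a = w l a"
| "tree_weight w (Node L R) a = tree_weight w L 0 * tree_weight w R (Suc a)"

text \<open>With \<open>e l\<close> equal to \<open>s * d l\<close> this becomes \<open>s\<close>
  times the total decoration.\<close>

fun leaf_sum :: "(nat \<Rightarrow> 'a::comm_ring_1) \<Rightarrow> itree \<Rightarrow> 'a" where
  "leaf_sum e (Leaf l) = e l"
| "leaf_sum e (Node L R) = leaf_sum e L + leaf_sum e R"

lemma tsize_relabel [simp]: "tsize (relabel g T) = tsize T"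
  by (induction T) auto

lemma relabel_graft: "relabel g (graft T k T') = graft (relabel g T) k (relabel g T')"
  by (induction T k T' rule: graft.induct) auto

lemma leaves_graft: "1 \<le> k \<Longrightarrow> k \<le> tsize T' \<Longrightarrow> leaves (graft T k T') = leaves T \<union> leaves T'"
  by (induction T k T' rule: graft.induct) auto

lemma tsize_graft: "1 \<le> k \<Longrightarrow> k \<le> tsize T' \<Longrightarrow> tsize (graft T k T') = Suc (tsize T + tsize T')"
  by (induction T k T' rule: graft.induct) auto

lemma leaf_distinct_graft:
  assumes "1 \<le> k" "k \<le> tsize T'" "leaf_distinct T" "leaf_distinct T'" "leaves T \<inter> leaves T' = {}"
  shows "leaf_distinct (graft T k T')"
  using assms
  proof (induction T k T' rule: graft.induct)
    case (2 T k L R)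
    have dis: "leaves T \<inter> leaves L = {}" "leaves T \<inter> leaves R = {}" using 2(7) by auto
    consider "k = 1" | "k \<noteq> 1" "k - 1 \<le> tsize L" | "k \<noteq> 1" "\<not> k - 1 \<le> tsize L" by blast
    then show ?case
    proof cases
      case 1 then show ?thesis using 2 by simp
    next
      case c: 2
      have "leaf_distinct (graft T (k - 1) L)" "leaves (graft T (k - 1) L) = leaves T \<union> leaves L"
        using 2 c dis leaves_graft[of "k - 1" L] by auto
      then show ?thesis using c 2 by auto
    next
      case c: 3
      have "leaf_distinct (graft T (k - 1 - tsize L) R)"
        "leaves (graft T (k - 1 - tsize L) R) = leaves T \<union> leaves R"
        using 2 c dis leaves_graft[of "k - 1 - tsize L" R] by auto
      then show ?thesis using c 2 by auto
    qed
  qed auto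

lemma tree_weight_relabel: "tree_weight w (relabel g T) a = tree_weight (\<lambda>l. w (g l)) T a"
  by (induction T arbitrary: a) auto

lemma tree_weight_cong:
  "(\<And>l. l \<in> leaves T \<Longrightarrow> w l = w' l) \<Longrightarrow> tree_weight w T a = tree_weight w' T a"
  by (induction T arbitrary: a) auto

lemma finite_leaves [simp]: "finite (leaves T)"
  by (induction T) auto

lemma leaf_sum_relabel: "leaf_sum e (relabel g T) = leaf_sum (\<lambda>l. e (g l)) T"
  by (induction T) auto

lemma leaf_sum_eq: "leaf_distinct T \<Longrightarrow> leaf_sum e T = (\<Sum>l\<in>leaves T. e l)"
  by (induction T) (auto simp: sum.union_disjoint)

lemma nu_pairs_leaves: "(l, v) \<in> nu_pairs T a \<Longrightarrow> l \<in> leaves T"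
  by (induction T arbitrary: a) auto

text \<open>A leaf label occurs in just one subtree, so the definite description of its count can be
  evaluated there. This identifies \<open>tree_weight\<close> with the product in
  \<open>omega\<close>.\<close>

lemma tree_weight_eq_prod:
  assumes "leaf_distinct T"
  shows "tree_weight w T a = (\<Prod>l\<in>leaves T. w l (THE v. (l, v) \<in> nu_pairs T a))"
  using assms
proof (induction T arbitrary: a)
  case (Leaf l)
  then show ?case by simp
next
  case (Node L R)
  have L: "(l, v) \<in> nu_pairs (Node L R) a \<longleftrightarrow> (l, v) \<in> nu_pairs L 0" if "l \<in> leaves L" for l v
    using Node.prems that nu_pairs_leaves[of l v R "Suc a"] by auto
  have R: "(l, v) \<in> nu_pairs (Node L R) a \<longleftrightarrow> (l, v) \<in> nu_pairs R (Suc a)" if "l \<in> leaves R" for l v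
    using Node.prems that nu_pairs_leaves[of l v L 0] by auto
  show ?case
    using Node.prems
    by (simp add: prod.union_disjoint L R Node.IH del: nu_pairs.simps)
qed

text \<open>Matches the pre-order numbering of edges: the edge above the root, then the left
  subtree, then the right one.\<close>

lemma sum_atLeastAtMost_split:
  fixes f :: "nat \<Rightarrow> 'a::comm_monoid_add"
  shows "(\<Sum>k=1..Suc (p + q). f k) = f 1 + (\<Sum>k=1..p. f (Suc k)) + (\<Sum>k=1..q. f (Suc (p + k)))"
proof -
  have "(\<Sum>k=1..Suc (p + q). f k) = f 1 + (\<Sum>k=Suc 1..Suc (p + q). f k)"
    by (rule sum.atLeast_Suc_atMost) simp
  also have "(\<Sum>k=Suc 1..Suc (p + q). f k) = (\<Sum>k=1..p + q. f (Suc k))"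
    by (rule sum.shift_bounds_cl_Suc_ivl)
  also have "\<dots> = (\<Sum>k=1..p. f (Suc k)) + (\<Sum>k=p + 1..p + q. f (Suc k))"
    by (rule sum.ub_add_nat) simp
  also have "(\<Sum>k=p + 1..p + q. f (Suc k)) = (\<Sum>k=1..q. f (Suc (p + k)))"
    using sum.shift_bounds_cl_nat_ivl[of "\<lambda>k. f (Suc k)" 1 p q] by (simp add: add.commute)
  finally show ?thesis by (simp add: add.assoc)
qed

text \<open>Grafting above a vertex lengthens by one the maximal right path through that vertex.
  Summing over all edges therefore hits the leaf with branch-left count \<open>\<nu>\<close> exactly \<open>\<nu> + 1\<close> times.
  The correction \<open>of_nat a * \<dots>\<close> stands for the \<open>a\<close> edges of the path through the root that lie above
  the subtree.\<close>

lemma sum_tree_weight_graft: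
  fixes w :: "nat \<Rightarrow> nat \<Rightarrow> 'a::comm_ring_1"
  assumes w: "\<And>l v. of_nat (Suc v) * w l (Suc v) = (e l + of_nat v - 1) * w l v"
  shows "(\<Sum>k=1..tsize T'. tree_weight w (graft T k T') a)
           + of_nat a * (tree_weight w T 0 * tree_weight w T' (Suc a))
         = tree_weight w T 0 * ((leaf_sum e T' - 1 + of_nat a) * tree_weight w T' a)"
proof (induction T' arbitrary: a)
  case (Leaf l)
  have "w l (Suc a) + of_nat a * w l (Suc a) = (e l + of_nat a - 1) * w l a"
    using w[where l = l and v = a] by (simp add: algebra_simps)
  then have "tree_weight w T 0 * (w l (Suc a) + of_nat a * w l (Suc a)) =
    tree_weight w T 0 * ((e l + of_nat a - 1) * w l a)" by simp
  then show ?case by (simp add: algebra_simps)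
next
  case (Node L R)
  let ?t = "tree_weight w T 0"
  let ?L = "\<lambda>a. tree_weight w L a" and ?R = "\<lambda>a. tree_weight w R a"
  \<comment> \<open>The terms come from the edge above the root, from the edges ending in
    \<open>L\<close>, where counts restart at 0, and from those ending in \<open>R\<close>, which
    inherits the count \<open>Suc a\<close>.\<close>
  have sum: "(\<Sum>k=1..tsize (Node L R). tree_weight w (graft T k (Node L R)) a)
      = ?t * (?L 0 * ?R (Suc (Suc a))) + (\<Sum>k=1..tsize L. tree_weight w (graft T k L) 0) * ?R (Suc a)
        + ?L 0 * (\<Sum>k=1..tsize R. tree_weight w (graft T k R) (Suc a))"
  proof -
    have "(\<Sum>k=1..tsize L. tree_weight w (graft T (Suc k) (Node L R)) a)
        = (\<Sum>k=1..tsize L. tree_weight w (graft T k L) 0) * ?R (Suc a)"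
      unfolding sum_distrib_right by (intro sum.cong) auto
    moreover have "(\<Sum>k=1..tsize R. tree_weight w (graft T (Suc (tsize L + k)) (Node L R)) a)
        = ?L 0 * (\<Sum>k=1..tsize R. tree_weight w (graft T k R) (Suc a))"
      unfolding sum_distrib_left by (intro sum.cong) auto
    moreover have "tsize (Node L R) = Suc (tsize L + tsize R)" by simp
    ultimately show ?thesis by (simp only: sum_atLeastAtMost_split) simp
  qed
  have sumL: "(\<Sum>k=1..tsize L. tree_weight w (graft T k L) 0) = ?t * ((leaf_sum e L - 1) * ?L 0)"
    using Node.IH(1)[of 0] by simp
  \<comment> \<open>After multiplication by \<open>?L 0\<close>, one of the \<open>a + 1\<close>
    subtracted copies cancels the term of the edge above the root, the other \<open>a\<close> cancel
    the correction in the claim.\<close>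
  have sumR: "(\<Sum>k=1..tsize R. tree_weight w (graft T k R) (Suc a))
      = ?t * ((leaf_sum e R + of_nat a) * ?R (Suc a)) - of_nat (Suc a) * (?t * ?R (Suc (Suc a)))"
    using Node.IH(2)[of "Suc a"] by (simp add: algebra_simps)
  show ?case unfolding sum sumL sumR by (simp add: algebra_simps)
qed

section \<open>Binomial coefficients in a Q-algebra\<close>

lemma of_nat_qinv:
  assumes qalg: "\<forall>n::nat. n > 0 \<longrightarrow> (\<exists>u::'a::comm_ring_1. of_nat n * u = 1)"
    and "n > 0"
  shows "of_nat n * (qinv n :: 'a) = 1"
proof -
  obtain u :: 'a where u: "of_nat n * u = 1" using qalg assms by blast
  have "v = u" if "of_nat n * v = 1" for v :: 'a
    using u that by (metis mult.assoc mult.commute mult_1)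
  then show ?thesis unfolding qinv_def using u by (metis (mono_tags, lifting) theI)
qed

lemma qinv_unique:
  assumes qalg: "\<forall>n::nat. n > 0 \<longrightarrow> (\<exists>u::'a::comm_ring_1. of_nat n * u = 1)"
    and "n > 0" "of_nat n * v = (1::'a)"
  shows "v = qinv n"
  using of_nat_qinv[OF assms(1,2)] assms(3) by (metis mult.assoc mult.commute mult_1)

text \<open>Absorption identity: the leading factor \<open>y + 1\<close> leaves the product and
  \<open>v + 1\<close> leaves the factorial.\<close>

lemma binomA_Suc:
  assumes qalg: "\<forall>n::nat. n > 0 \<longrightarrow> (\<exists>u::'a::comm_ring_1. of_nat n * u = 1)"
  shows "of_nat (Suc v) * (binomA (y + 1) (Suc v) :: 'a) = of_int (y + 1) * binomA y v"
proof -
  have 1: "(\<Prod>j<Suc v. y + 1 - int j) = (y + 1) * (\<Prod>j<v. y - int j)"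
    by (subst prod.lessThan_Suc_shift) (simp add: algebra_simps)
  have 2: "of_nat (Suc v) * qinv (fact (Suc v)) = (qinv (fact v) :: 'a)"
  proof (rule qinv_unique[OF qalg])
    have "of_nat (fact v) * (of_nat (Suc v) * qinv (fact (Suc v)))
        = of_nat (fact (Suc v)) * (qinv (fact (Suc v)) :: 'a)"
      by (simp only: fact_Suc of_nat_mult mult_ac of_nat_id)
    then show "of_nat (fact v) * (of_nat (Suc v) * qinv (fact (Suc v))) = (1::'a)"
      using of_nat_qinv[OF qalg, of "fact (Suc v)"] by (simp only: fact_gt_zero)
  qed simp
  show ?thesis unfolding binomA_def 1 2[symmetric] of_int_mult by (simp only: mult_ac)
qed

text \<open>The hypothesis of \<open>sum_tree_weight_graft\<close> for leaf weights, with
  \<open>x = s * d l\<close> in the place of \<open>e l\<close>.\<close>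

lemma binomA_weight:
  assumes qalg: "\<forall>n::nat. n > 0 \<longrightarrow> (\<exists>u::'a::comm_ring_1. of_nat n * u = 1)"
  shows "of_nat (Suc v) * (binomA (x + int (Suc v) - 2) (Suc v) :: 'a)
     = (of_int x + of_nat v - 1) * binomA (x + int v - 2) v"
  using binomA_Suc[OF qalg, where y = "x + int v - 2" and v = v] by (simp add: algebra_simps)


section \<open>Splitting the monomial of an insertion\<close>

section \<open>Monomials attached to sets of terminal labels\<close>

text \<open>Isolates what \<open>hat_a\<close> uses of a diagram, so that the splitting becomes a
  statement about sets of labels.\<close>

definition term_monomial ::
  "(nat \<Rightarrow> nat \<Rightarrow> 'a::comm_ring_1) \<Rightarrow> nat set \<Rightarrow> nat \<Rightarrow> (nat \<Rightarrow> nat) \<Rightarrow> 'a" where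
  "term_monomial a T n d =
     (\<Prod>t\<in>T - {Min T}. a (d t) (t - Max {t' \<in> T. t' < t})) * (\<Prod>i\<in>{1..n} - T. a (d i) 0)"

lemma hat_a_eq: "hat_a a C d = term_monomial a (term_labels C) (card C) d"
  by (simp add: hat_a_def term_monomial_def Let_def)

lemma Max_mono_image:
  assumes "finite X" "X \<noteq> {}"
  shows "Max (Suc ` X) = Suc (Max X)" "Max ((+) m ` X) = m + Max X"
  using assms mono_Max_commute[of Suc X] mono_Max_commute[of "(+) m" X]
  by (auto simp: mono_def)

text \<open>The shifted labels from \<open>A\<close> end at \<open>m + 1\<close>. If
  \<open>n > 1\<close>, those from \<open>B\<close> resume at \<open>m + Min B\<close>, the gap
  \<open>Min B - 1\<close> gives the extra factor, and all other gaps stay inside one part. If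
  \<open>n = 1\<close>, nothing of \<open>B\<close> survives in \<open>T\<close>, and the extra
  factor comes from the root, which has become nonterminal.\<close>

lemma term_monomial_join:
  fixes a :: "nat \<Rightarrow> nat \<Rightarrow> 'a::comm_ring_1"
  assumes A: "A \<subseteq> {1..m}" "m \<in> A" and B: "B \<subseteq> {1..n}" "n \<in> B"
    and B1: "n = 1 \<or> 1 \<notin> B"
    and T: "T = Suc ` A \<union> (+) m ` (B - {1})"
    and d1: "\<And>j. j \<in> {1..m} \<Longrightarrow> d (Suc j) = d2 j"
    and d2: "d 1 = d1 1" "\<And>j. j \<in> {2..n} \<Longrightarrow> d (m + j) = d1 j"
  shows "term_monomial a T (n + m) d =
    term_monomial a A m d2 * (term_monomial a B n d1 * a (d1 (Min B)) (Min B - 1))"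
proof -
  have fin: "finite A" "finite B" "finite T"
    using finite_subset[OF A(1)] finite_subset[OF B(1)] by (auto simp: T)
  have mn: "1 \<le> m" "1 \<le> n" using A B by auto
  have A_le: "1 \<le> t \<and> t \<le> m" if "t \<in> A" for t using A that by auto
  have B_le: "2 \<le> t \<and> t \<le> n" if "t \<in> B - {1}" for t using B that by fastforce
  define F where "F t = a (d t) (t - Max {t' \<in> T. t' < t})" for t
  define G where "G i = a (d i) 0" for i
  have minA: "Min A \<in> A" using fin A Min_in by blast
  have minT: "Min T = Suc (Min A)"
  proof (rule Min_eqI[OF fin(3)])
    show "Suc (Min A) \<in> T" using minA T by blast
    show "Suc (Min A) \<le> y" if "y \<in> T" for y
    proof -
      from that T consider t where "t \<in> A" "y = Suc t" | t where "t \<in> B - {1}" "y = m + t" by blast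
      then show ?thesis
      proof cases
        case 1 then show ?thesis using fin by simp
      next
        case 2 then show ?thesis using B_le[of t] A_le[OF minA] by simp
      qed
    qed
  qed
  have dis: "Suc ` X \<inter> (+) m ` Y = {}" if "X \<subseteq> {1..m}" "Y \<subseteq> {2..n}" for X Y
    using that by fastforce
  have B2: "B - {1} \<subseteq> {2..n}" using B_le by (meson atLeastAtMost_iff subsetI)

  have "T - {Min T} = Suc ` (A - {Min A}) \<union> (+) m ` (B - {1})"
  proof -
    have "Suc (Min A) \<noteq> m + t" if "t \<in> B - {1}" for t using B_le[OF that] A_le[OF minA] by linarith
    then have "Suc (Min A) \<notin> (+) m ` (B - {1})" by blast
    then show ?thesis unfolding minT unfolding T by blast
  qed
  then have "(\<Prod>t\<in>T - {Min T}. F t) = (\<Prod>t\<in>Suc ` (A - {Min A}). F t) * (\<Prod>t\<in>(+) m ` (B - {1}). F t)"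
    using fin dis[of "A - {Min A}" "B - {1}"] A(1) B2 by (simp add: prod.union_disjoint subset_iff)
  moreover have "(\<Prod>t\<in>Suc ` (A - {Min A}). F t) = (\<Prod>t\<in>A - {Min A}. a (d2 t) (t - Max {t' \<in> A. t' < t}))"
  proof (rule prod.reindex_cong[of Suc, OF _ refl])
    show "inj_on Suc (A - {Min A})" by simp
    fix t assume t: "t \<in> A - {Min A}"
    have "{t' \<in> T. t' < Suc t} = Suc ` {t' \<in> A. t' < t}"
    proof -
      have "\<not> m + u < Suc t" if "u \<in> B - {1}" for u using B_le[OF that] A_le[of t] t by auto
      then show ?thesis unfolding T by auto
    qed
    moreover have "Min A \<in> {t' \<in> A. t' < t}" using minA t fin by (simp add: order.not_eq_order_implies_strict)
    ultimately have "Max {t' \<in> T. t' < Suc t} = Suc (Max {t' \<in> A. t' < t})"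
      using Max_mono_image(1)[of "{t' \<in> A. t' < t}"] fin by auto
    then show "F (Suc t) = a (d2 t) (t - Max {t' \<in> A. t' < t})"
      using d1[of t] A_le[of t] t by (simp add: F_def)
  qed
  ultimately have first: "(\<Prod>t\<in>T - {Min T}. F t) =
      (\<Prod>t\<in>A - {Min A}. a (d2 t) (t - Max {t' \<in> A. t' < t})) * (\<Prod>t\<in>B - {1}. F (m + t))"
    by (simp add: prod.reindex)

  have "{1..n + m} - T = Suc ` ({1..m} - A) \<union> insert 1 ((+) m ` ({2..n} - B))"
  proof -
    have "{1..n + m} = Suc ` {1..m} \<union> insert 1 ((+) m ` {2..n})"
      using mn by auto
    moreover have "1 \<notin> T"
    proof -
      have "1 \<noteq> m + u" if "u \<in> B - {1}" for u using B_le[OF that] by linarith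
      moreover have "1 \<noteq> Suc u" if "u \<in> A" for u using A_le[OF that] by linarith
      ultimately show ?thesis unfolding T by blast
    qed
    moreover have "Suc ` {1..m} - T = Suc ` ({1..m} - A)"
      using dis[of "{1..m}" "B - {1}"] B2 unfolding T by blast
    moreover have "(+) m ` {2..n} - T = (+) m ` ({2..n} - B)"
    proof -
      have "(+) m ` {2..n} - T = (+) m ` {2..n} - (+) m ` (B - {1})"
        using dis[of A "{2..n}"] A(1) unfolding T by blast
      also have "\<dots> = (+) m ` ({2..n} - (B - {1}))" by (rule image_set_diff[symmetric]) simp
      also have "{2..n} - (B - {1}) = {2..n} - B" by auto
      finally show ?thesis .
    qed
    ultimately show ?thesis by (metis Un_Diff insert_Diff_if)
  qed
  moreover have "1 \<notin> (+) m ` ({2..n} - B)" "Suc ` ({1..m} - A) \<inter> insert 1 ((+) m ` ({2..n} - B)) = {}"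
    using dis[of "{1..m} - A" "{2..n} - B"] by auto
  ultimately have "(\<Prod>i\<in>{1..n + m} - T. G i) =
      (\<Prod>i\<in>Suc ` ({1..m} - A). G i) * (G 1 * (\<Prod>i\<in>(+) m ` ({2..n} - B). G i))"
    by (simp add: prod.union_disjoint)
  also have "(\<Prod>i\<in>Suc ` ({1..m} - A). G i) = (\<Prod>i\<in>{1..m} - A. a (d2 i) 0)"
    using d1 by (simp add: prod.reindex G_def)
  also have "(\<Prod>i\<in>(+) m ` ({2..n} - B). G i) = (\<Prod>i\<in>{2..n} - B. a (d1 i) 0)"
    using d2(2) by (simp add: prod.reindex G_def)
  finally have second: "(\<Prod>i\<in>{1..n + m} - T. G i) =
      (\<Prod>i\<in>{1..m} - A. a (d2 i) 0) * (a (d1 1) 0 * (\<Prod>i\<in>{2..n} - B. a (d1 i) 0))"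
    using d2(1) by (simp add: G_def)

  have rest: "(\<Prod>t\<in>B - {1}. F (m + t)) * (a (d1 1) 0 * (\<Prod>i\<in>{2..n} - B. a (d1 i) 0))
      = term_monomial a B n d1 * a (d1 (Min B)) (Min B - 1)"
  proof (cases "n = 1")
    case True
    then have "B = {1}" using B by auto
    then show ?thesis using True by (simp add: term_monomial_def)
  next
    case False
    then have nB: "1 \<notin> B" using B1 by simp
    then have Bd: "B - {1} = B" by simp
    have B_ge: "2 \<le> t \<and> t \<le> n" if "t \<in> B" for t using B_le that unfolding Bd by blast
    have minB: "Min B \<in> B" using fin B Min_in by blast
    have "(\<Prod>t\<in>B - {1}. F (m + t)) = F (m + Min B) * (\<Prod>t\<in>B - {Min B}. F (m + t))"
      unfolding Bd using prod.remove[OF fin(2) minB] .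
    also have "F (m + Min B) = a (d1 (Min B)) (Min B - 1)"
    proof -
      \<comment> \<open>The predecessor of \<open>m + Min B\<close> in \<open>T\<close> is therefore
        \<open>Suc m\<close>, the last label coming from \<open>A\<close>.\<close>
      have "{t' \<in> T. t' < m + Min B} = Suc ` A"
      proof -
        have "Suc t < m + Min B" if "t \<in> A" for t using A_le[OF that] B_ge[OF minB] by linarith
        moreover have "\<not> m + t < m + Min B" if "t \<in> B" for t using fin(2) that by (simp add: not_less)
        ultimately show ?thesis unfolding T by auto
      qed
      moreover have "Max A = m" using fin A A_le by (intro Max_eqI) auto
      ultimately have "Max {t' \<in> T. t' < m + Min B} = Suc m" 
        using Max_mono_image(1)[of A] fin A by auto
      then show ?thesis using d2(2)[of "Min B"] B_ge[OF minB] by (simp add: F_def)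
    qed
    also have "(\<Prod>t\<in>B - {Min B}. F (m + t)) = (\<Prod>t\<in>B - {Min B}. a (d1 t) (t - Max {t' \<in> B. t' < t}))"
    proof (intro prod.cong refl)
      fix t assume t: "t \<in> B - {Min B}"
      let ?X = "{t' \<in> B. t' < t}"
      have X: "finite ?X" "Min B \<in> ?X"
        using minB t fin by (simp_all add: order.not_eq_order_implies_strict)
      \<comment> \<open>As \<open>t\<close> is not \<open>Min B\<close>, it has a predecessor in
        \<open>B\<close>; this is at least 2 and so beats the labels from \<open>A\<close>, which
        end at \<open>m + 1\<close>.\<close>
      have "Max {t' \<in> T. t' < m + t} = m + Max ?X"
      proof (rule Max_eqI)
        show "finite {t' \<in> T. t' < m + t}" using fin by simp
        have "Max ?X \<in> ?X" using X Max_in by blast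
        then have "Max ?X \<in> B - {1}" "Max ?X < t" using nB by auto
        then show "m + Max ?X \<in> {t' \<in> T. t' < m + t}" unfolding T by simp
        fix y assume y: "y \<in> {t' \<in> T. t' < m + t}"
        then consider u where "u \<in> A" "y = Suc u" | u where "u \<in> B" "y = m + u" unfolding T by blast
        then show "y \<le> m + Max ?X"
        proof cases
          case 1
          have "2 \<le> Min B" using B_ge[OF minB] by simp
          moreover have "Min B \<le> Max ?X" using X by simp
          ultimately show ?thesis using 1 A_le[of u] by simp
        next
          case 2
          then have "u \<in> ?X" using y by simp
          then show ?thesis using 2 X(1) by simp
        qed
      qed
      then show "F (m + t) = a (d1 t) (t - Max ?X)"
        using d2(2)[of t] B_ge[of t] t by (simp add: F_def)
    qed
    finally have "(\<Prod>t\<in>B - {1}. F (m + t)) =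
      a (d1 (Min B)) (Min B - 1) * (\<Prod>t\<in>B - {Min B}. a (d1 t) (t - Max {t' \<in> B. t' < t}))" .
    moreover have "a (d1 1) 0 * (\<Prod>i\<in>{2..n} - B. a (d1 i) 0) = (\<Prod>i\<in>{1..n} - B. a (d1 i) 0)"
    proof -
      have "{1..n} - B = insert 1 ({2..n} - B)" using mn nB by auto
      then show ?thesis by simp
    qed
    ultimately show ?thesis by (simp add: term_monomial_def mult_ac)
  qed
  have "term_monomial a T (n + m) d = (\<Prod>t\<in>T - {Min T}. F t) * (\<Prod>i\<in>{1..n + m} - T. G i)"
    by (simp add: term_monomial_def F_def G_def)
  also have "\<dots> = term_monomial a A m d2 *
      ((\<Prod>t\<in>B - {1}. F (m + t)) * (a (d1 1) 0 * (\<Prod>i\<in>{2..n} - B. a (d1 i) 0)))"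
    unfolding first second by (simp add: term_monomial_def mult_ac)
  finally show ?thesis unfolding rest .
qed

section \<open>Insertion trees as grafts, and their size and leaves\<close>

section \<open>The insertion tree of an insertion\<close>

text \<open>Uniqueness of the decomposition evaluates the choices in one unfolding: the first
  component is \<open>K\<close>, the normalised parts are \<open>C\<close> and \<open>D\<close>, the
  position is \<open>k\<close>.\<close>

lemma (in insertion) tree_fuel_ins:
  "tree_fuel (Suc f) E lab =
     graft (tree_fuel f C (\<lambda>c. lab (denorm (E - K) c))) k (tree_fuel f D (\<lambda>c. lab (denorm K c)))"
proof -
  have "card E \<noteq> 1" using card_ins C_facts(1) D_facts(1) by simp
  then show ?thesis
    by (simp only: tree_fuel.simps if_False Let_def first_comp_ins norm_K(1) norm_rest(1) the_position)
qed

lemma (in insertion) denorm_mem: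
  "c \<in> C \<Longrightarrow> denorm (E - K) c \<in> E" "c \<in> D \<Longrightarrow> denorm K c \<in> E"
  using norm_rest(2) norm_K(2) ins_chord_eq by auto

text \<open>The shape of the tree depends only on the diagram; \<open>lab\<close> merely names the
  leaves. Two fuel values are allowed, so independence of sufficient fuel is proved along the
  way.\<close>

lemma tree_fuel_relabel:
  assumes "rooted_connected N X" "N \<le> f" "N \<le> f'" "\<And>c. c \<in> X \<Longrightarrow> lab c = g (lab' c)"
  shows "tree_fuel f X lab = relabel g (tree_fuel f' X lab')"
  using assms
proof (induction arbitrary: f f' lab lab' rule: rooted_connected_induct)
  case (single C)
  obtain c where c: "C = {c}" using rooted_connected_1[OF single(1)] by blast
  obtain f1 f2 where "f = Suc f1" "f' = Suc f2" using single(2,3) by (cases f; cases f') auto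
  then show ?case using c single(4) by simp
next
  case (insertion n m k C D)
  interpret insertion n m k C D by (rule insertion(1))
  note prems = insertion(4-6)
  obtain f1 f2 where f: "f = Suc f1" "f' = Suc f2"
    using prems(1,2) C_facts(1) by (cases f; cases f') auto
  have le: "n \<le> f1" "n \<le> f2" "m \<le> f1" "m \<le> f2"
    using prems(1,2) f C_facts(1) D_facts(1) by auto
  have "tree_fuel f1 C (\<lambda>c. lab (denorm (E - K) c)) =
      relabel g (tree_fuel f2 C (\<lambda>c. lab' (denorm (E - K) c)))"
    by (rule insertion(2)[OF le(1,2)]) (use prems(3) denorm_mem(1) in auto)
  moreover have "tree_fuel f1 D (\<lambda>c. lab (denorm K c)) =
      relabel g (tree_fuel f2 D (\<lambda>c. lab' (denorm K c)))"
    by (rule insertion(3)[OF le(3,4)]) (use prems(3) denorm_mem(2) in auto)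
  ultimately show ?case unfolding f tree_fuel_ins relabel_graft by simp
qed

text \<open>Each graft adds one vertex, which gives the size \<open>2 * N - 1\<close>. Hence the
  positions \<open>1, ..., 2 * m - 1\<close> are exactly the edges of the tree of
  \<open>D\<close>.\<close>

lemma tree_fuel_props:
  assumes "rooted_connected N X" "N \<le> f"
  shows "leaves (tree_fuel f X lab) = lab ` X \<and> tsize (tree_fuel f X lab) = 2 * N - 1
    \<and> (inj_on lab X \<longrightarrow> leaf_distinct (tree_fuel f X lab))"
  using assms
proof (induction arbitrary: f lab rule: rooted_connected_induct)
  case (single C)
  obtain c where c: "C = {c}" using rooted_connected_1[OF single(1)] by blast
  obtain f1 where "f = Suc f1" using single(2) by (cases f) auto
  then show ?case using c by simp
next
  case (insertion n m k C D)
  interpret insertion n m k C D by (rule insertion(1))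
  obtain f1 where f: "f = Suc f1" using insertion(4) C_facts(1) by (cases f) auto
  have le: "n \<le> f1" "m \<le> f1" using insertion(4) f C_facts(1) D_facts(1) by auto
  let ?lC = "\<lambda>c. lab (denorm (E - K) c)" and ?lD = "\<lambda>c. lab (denorm K c)"
  let ?tC = "tree_fuel f1 C ?lC" and ?tD = "tree_fuel f1 D ?lD"
  note IC = insertion(2)[OF le(1), of ?lC] and ID = insertion(3)[OF le(2), of ?lD]
  have size: "tsize ?tC = 2 * n - 1" "tsize ?tD = 2 * m - 1" using IC ID by auto
  have k': "1 \<le> k" "k \<le> tsize ?tD" using k size by auto
  have lC: "?lC ` C = lab ` mapc h ` C" unfolding image_image
    using norm_rest(2) by (intro image_cong) auto
  have lD: "?lD ` D = lab ` K" unfolding image_image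
    using norm_K(2) by (intro image_cong) auto
  have lvs: "leaves ?tC = lab ` mapc h ` C" "leaves ?tD = lab ` K" using IC ID lC lD by auto
  have eq: "tree_fuel f E lab = graft ?tC k ?tD" unfolding f tree_fuel_ins ..
  have "leaves (graft ?tC k ?tD) = lab ` E"
    unfolding leaves_graft[OF k'] lvs by (simp add: ins_chord_eq image_Un)
  moreover have "tsize (graft ?tC k ?tD) = 2 * (n + m) - 1"
    unfolding tsize_graft[OF k'] size using C_facts(1) D_facts(1) by simp
  moreover have "leaf_distinct (graft ?tC k ?tD)" if inj: "inj_on lab E"
  proof (rule leaf_distinct_graft[OF k'])
    have inj': "inj_on lab (mapc h ` C)" "inj_on lab K"
      using inj ins_chord_eq by (auto intro: inj_on_subset)
    have "inj_on (lab \<circ> mapc h) C" "inj_on (lab \<circ> mapc H) D"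
      using inj' inj_on_mapc[OF mono_h] inj_on_mapc[OF mono_H] by (auto intro: comp_inj_on)
    then have "inj_on ?lC C" "inj_on ?lD D"
      using norm_rest(2) norm_K(2) by (auto simp: inj_on_def)
    then show "leaf_distinct ?tC" "leaf_distinct ?tD" using IC ID by auto
    show "leaves ?tC \<inter> leaves ?tD = {}"
      unfolding lvs using inj_on_image_Int[OF inj, of "mapc h ` C" K] parts_disjoint ins_chord_eq by auto
  qed
  ultimately show ?case unfolding eq by simp
qed

lemma ins_tree_props:
  assumes "rooted_connected n C"
  shows "leaves (ins_tree C) = {1..n}" "tsize (ins_tree C) = 2 * n - 1" "leaf_distinct (ins_tree C)"
  using tree_fuel_props[OF assms, of n "label C"] label_bij[OF assms] rooted_connectedD(3)[OF assms]
  by (auto simp: ins_tree_def bij_betw_def)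

lemma (in insertion) ins_tree_ins:
  "ins_tree E = graft (relabel outer_label (ins_tree C)) k (relabel Suc (ins_tree D))"
proof -
  obtain f where f: "n + m = Suc f" using C_facts(1) by (cases "n + m") auto
  have le: "n \<le> f" "m \<le> f" using f C_facts(1) D_facts(1) by auto
  have "tree_fuel f C (\<lambda>c. label E (denorm (E - K) c)) = relabel outer_label (tree_fuel n C (label C))"
    by (rule tree_fuel_relabel[OF C le(1)]) (use norm_rest(2) label_outer_inj in auto)
  moreover have "tree_fuel f D (\<lambda>c. label E (denorm K c)) = relabel Suc (tree_fuel m D (label D))"
    by (rule tree_fuel_relabel[OF D le(2)]) (use norm_K(2) label_inner in auto)
  ultimately show ?thesis
    unfolding ins_tree_def card_ins C_facts(3) D_facts(3) f tree_fuel_ins by simp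
qed

definition leaf_weight :: "int \<Rightarrow> (nat \<Rightarrow> nat) \<Rightarrow> nat \<Rightarrow> nat \<Rightarrow> 'a::comm_ring_1" where
  "leaf_weight s d l v = binomA (s * int (d l) + int v - 2) v"

lemma omega_eq_tree_weight:
  assumes "rooted_connected n C"
  shows "omega s C d = tree_weight (leaf_weight s d) (ins_tree C) 0"
  unfolding tree_weight_eq_prod[OF ins_tree_props(3)[OF assms]]
  by (simp add: omega_def leaf_weight_def nu_def ins_tree_props(1)[OF assms] rooted_connectedD(3)[OF assms])

section \<open>Weights and decorations under insertion\<close>

section \<open>Decorated diagrams\<close>

text \<open>Decorations are indexed by labels, so they follow the renumbering in
  \<open>label_outer\<close> and \<open>label_inner\<close>.\<close>

definition join_dec :: "nat \<Rightarrow> (nat \<Rightarrow> nat) \<Rightarrow> (nat \<Rightarrow> nat) \<Rightarrow> nat \<Rightarrow> nat" where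
  "join_dec m d1 d2 j = (if j = 1 then d1 1 else if j \<le> Suc m then d2 (j - 1) else d1 (j - m))"

context insertion
begin

text \<open>The base chord of \<open>E\<close> is that of \<open>D\<close> with its label raised by
  one, so raising the index by one keeps its factor. The gap between the two parts supplies the base
  factor of \<open>C\<close> at index 1.\<close>

lemma hat_a_ins:
  "hat_a a E (join_dec m d1 d2) * a (join_dec m d1 d2 (base E)) (base E - Suc k')
   = (hat_a a C d1 * a (d1 (base C)) (base C - 1)) * (hat_a a D d2 * a (d2 (base D)) (base D - k'))"
proof -
  have "hat_a a E (join_dec m d1 d2) = hat_a a D d2 * (hat_a a C d1 * a (d1 (base C)) (base C - 1))"
    unfolding hat_a_eq base_def card_ins C_facts(3) D_facts(3)
    by (rule term_monomial_join[OF term_labels_subset[OF D] last_term_label[OF D]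
          term_labels_subset[OF C] last_term_label[OF C] _ term_labels_ins])
      (use one_notin_term_labels[OF C] in \<open>auto simp: join_dec_def\<close>)
  moreover have "base D \<in> {1..m}"
    by (rule base_in[OF D])
  then have "join_dec m d1 d2 (base E) = d2 (base D)" "base E - Suc k' = base D - k'"
    by (auto simp: base_ins join_dec_def)
  ultimately show ?thesis by (simp add: mult_ac)
qed

end

text \<open>The positions are the edges of the tree of \<open>D\<close>, so
  \<open>sum_tree_weight_graft\<close> applies with \<open>a = 0\<close>, where the correction
  vanishes; the leaf sum is \<open>s\<close> times the total decoration of \<open>D\<close>.\<close>

lemma sum_omega_ins:
  fixes s :: int
  assumes qalg: "\<forall>n::nat. n > 0 \<longrightarrow> (\<exists>u::'a::comm_ring_1. of_nat n * u = 1)"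
    and C: "rooted_connected n C" and D: "rooted_connected m D"
  shows "(\<Sum>k=1..2 * m - 1. omega s (ins_chord C k D) (join_dec m d1 d2))
      = omega s C d1 * ((of_int s * of_nat (\<Sum>i\<in>{1..m}. d2 i) - 1) * (omega s D d2 :: 'a))"
proof -
  let ?d = "join_dec m d1 d2"
  let ?w = "leaf_weight s ?d :: nat \<Rightarrow> nat \<Rightarrow> 'a"
  define g where "g l = (if l = 1 then 1 else m + l)" for l
  let ?TC = "relabel g (ins_tree C)" and ?TD = "relabel Suc (ins_tree D)"
  note pC = ins_tree_props[OF C] and pD = ins_tree_props[OF D]
  have "omega s (ins_chord C k D) ?d = tree_weight ?w (graft ?TC k ?TD) 0" if "k \<in> {1..2 * m - 1}" for k
  proof -
    interpret insertion n m k C D using C D that by unfold_locales auto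
    have "outer_label = g" by (simp add: fun_eq_iff outer_label_def g_def)
    then show ?thesis using omega_eq_tree_weight[OF rooted_connected_ins, of s ?d] ins_tree_ins by simp
  qed
  then have "(\<Sum>k=1..2 * m - 1. omega s (ins_chord C k D) ?d) = (\<Sum>k=1..tsize ?TD. tree_weight ?w (graft ?TC k ?TD) 0)"
    using pD(2) by simp
  also have "\<dots> = tree_weight ?w ?TC 0 * ((leaf_sum (\<lambda>l. of_int (s * int (?d l))) ?TD - 1) * tree_weight ?w ?TD 0)"
    using sum_tree_weight_graft[where w = ?w and e = "\<lambda>l. of_int (s * int (?d l))" and T = ?TC and T' = ?TD and a = 0]
      binomA_weight[OF qalg] by (simp add: leaf_weight_def)
  also have "tree_weight ?w ?TC 0 = omega s C d1"
    unfolding tree_weight_relabel omega_eq_tree_weight[OF C]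
    by (rule tree_weight_cong) (auto simp: pC g_def leaf_weight_def fun_eq_iff join_dec_def)
  also have "tree_weight ?w ?TD 0 = omega s D d2"
    unfolding tree_weight_relabel omega_eq_tree_weight[OF D]
    by (rule tree_weight_cong) (auto simp: pD leaf_weight_def fun_eq_iff join_dec_def)
  also have "leaf_sum (\<lambda>l. of_int (s * int (?d l))) ?TD = (of_int s * of_nat (\<Sum>i\<in>{1..m}. d2 i) :: 'a)"
    unfolding leaf_sum_relabel leaf_sum_eq[OF pD(3)] pD(1) of_nat_sum sum_distrib_left
    by (intro sum.cong) (auto simp: join_dec_def)
  finally show ?thesis .
qed

text \<open>Positive decorations of total \<open>N\<close> allow at most \<open>N\<close> chords,
  which bounds endpoints and decorations. The coefficients of \<open>gcomb\<close> are thus genuine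
  finite sums.\<close>

lemma finite_DD: "finite (DD N)"
proof (rule finite_subset)
  let ?F = "{d :: nat \<Rightarrow> nat. \<forall>x. (x \<in> {..N} \<longrightarrow> d x \<in> {..N}) \<and> (x \<notin> {..N} \<longrightarrow> d x = 0)}"
  show "finite (Pow ({..2 * N} \<times> {..2 * N}) \<times> ?F)"
    by (intro finite_cartesian_product finite_set_of_finite_funs) auto
  show "DD N \<subseteq> Pow ({..2 * N} \<times> {..2 * N}) \<times> ?F"
  proof
    fix z assume z: "z \<in> DD N"
    obtain C d where Cd: "z = (C, d)" by (cases z)
    define n where "n = card C"
    have C: "rooted_connected n C" and d: "dec_ok n d" and N: "(\<Sum>i\<in>{1..n}. d i) = N"
      using z by (auto simp: DD_def Cd n_def)
    have "n = (\<Sum>i\<in>{1..n}. 1)" by simp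
    also have "\<dots> \<le> (\<Sum>i\<in>{1..n}. d i)" using d by (intro sum_mono) (auto simp: dec_ok_def Suc_le_eq)
    finally have n: "n \<le> N" using N by simp
    have "d i \<le> N" for i
    proof (cases "i \<in> {1..n}")
      case True
      then show ?thesis using member_le_sum[of i "{1..n}" d] N by simp
    next
      case False
      then show ?thesis using d by (simp add: dec_ok_def)
    qed
    moreover have "d i = 0" if "i \<notin> {..N}" for i using d that n by (simp add: dec_ok_def)
    moreover have "C \<subseteq> {..2 * N} \<times> {..2 * N}"
    proof
      fix c assume "c \<in> C"
      then have "fst c \<le> 2 * n" "snd c \<le> 2 * n"
        using endpointsI[of c C] rooted_connectedD(4)[OF C] by auto
      then show "c \<in> {..2 * N} \<times> {..2 * N}" using n by (cases c) auto
    qed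
    ultimately show "z \<in> Pow ({..2 * N} \<times> {..2 * N}) \<times> ?F" unfolding Cd by auto
  qed
qed

lemma join_dec_simps:
  "join_dec m d1 d2 1 = d1 1"
  "j \<in> {1..m} \<Longrightarrow> join_dec m d1 d2 (Suc j) = d2 j"
  "2 \<le> j \<Longrightarrow> join_dec m d1 d2 (m + j) = d1 j"
  by (auto simp: join_dec_def)

lemma sum_join_dec:
  assumes "1 \<le> n"
  shows "(\<Sum>i\<in>{1..n + m}. join_dec m d1 d2 i) = (\<Sum>i\<in>{1..n}. d1 i) + (\<Sum>i\<in>{1..m}. d2 i)"
proof -
  obtain q where q: "n = Suc q" using assms by (cases n) auto
  have "(\<Sum>i=1..n + m. join_dec m d1 d2 i) = (\<Sum>i=1..Suc (m + q). join_dec m d1 d2 i)"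
    by (simp add: q add.commute)
  also have "\<dots> = join_dec m d1 d2 1 + (\<Sum>i=1..m. join_dec m d1 d2 (Suc i))
      + (\<Sum>i=1..q. join_dec m d1 d2 (Suc (m + i)))"
    by (rule sum_atLeastAtMost_split)
  also have "(\<Sum>i=1..m. join_dec m d1 d2 (Suc i)) = (\<Sum>i=1..m. d2 i)"
    by (intro sum.cong) (auto simp: join_dec_def)
  also have "(\<Sum>i=1..q. join_dec m d1 d2 (Suc (m + i))) = (\<Sum>i=1..q. d1 (Suc i))"
    by (intro sum.cong) (auto simp: join_dec_def)
  also have "join_dec m d1 d2 1 = d1 1" by (simp add: join_dec_def)
  finally have "(\<Sum>i=1..n + m. join_dec m d1 d2 i) = d1 1 + (\<Sum>i=1..q. d1 (Suc i)) + (\<Sum>i=1..m. d2 i)"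
    by (simp add: ac_simps)
  also have "d1 1 + (\<Sum>i=1..q. d1 (Suc i)) = (\<Sum>i=1..n. d1 i)"
    using sum_atLeastAtMost_split[of d1 q 0] by (simp add: q)
  finally show ?thesis .
qed

lemma dec_ok_join:
  assumes "dec_ok n d1" "dec_ok m d2" "1 \<le> n"
  shows "dec_ok (n + m) (join_dec m d1 d2)"
  unfolding dec_ok_def
proof (intro conjI ballI allI impI)
  fix i assume i: "i \<in> {1..n + m}"
  consider "i = 1" | "i \<noteq> 1" "i \<le> Suc m" | "Suc m < i" by linarith
  then show "0 < join_dec m d1 d2 i"
  proof cases
    case 1 then show ?thesis using assms by (simp add: join_dec_def dec_ok_def)
  next
    case 2
    then have "i - 1 \<in> {1..m}" using i by auto
    then show ?thesis using 2 assms(2) by (simp add: join_dec_def dec_ok_def)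
  next
    case 3
    then have "i - m \<in> {1..n}" using i by auto
    then show ?thesis using 3 assms(1) by (simp add: join_dec_def dec_ok_def)
  qed
next
  fix i assume i: "i \<notin> {1..n + m}"
  then consider "i = 0" | "n + m < i" by fastforce
  then show "join_dec m d1 d2 i = 0"
  proof cases
    case 1 then show ?thesis using assms(2) by (simp add: join_dec_def dec_ok_def)
  next
    case 2
    then have "join_dec m d1 d2 i = d1 (i - m)" "i - m \<notin> {1..n}"
      using assms(3) by (auto simp: join_dec_def)
    then show ?thesis using assms(1) by (simp add: dec_ok_def)
  qed
qed

lemma join_dec_inject:
  assumes "dec_ok n d1" "dec_ok m d2" "dec_ok n d1'" "dec_ok m d2'"
    and eq: "join_dec m d1 d2 = join_dec m d1' d2'"
  shows "d1 = d1'" "d2 = d2'"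
proof -
  show "d2 = d2'"
  proof
    fix j show "d2 j = d2' j"
    proof (cases "j \<in> {1..m}")
      case True
      then show ?thesis using join_dec_simps(2) eq by metis
    next
      case False
      then show ?thesis using assms by (simp add: dec_ok_def)
    qed
  qed
  show "d1 = d1'"
  proof
    fix j :: nat
    consider "j = 0" | "j = 1" | "2 \<le> j" by linarith
    then show "d1 j = d1' j"
    proof cases
      case 1 then show ?thesis using assms by (simp add: dec_ok_def)
    next
      case 2 then show ?thesis using join_dec_simps(1) eq by metis
    next
      case 3 then show ?thesis using join_dec_simps(3) eq by metis
    qed
  qed
qed

lemma join_dec_surj:
  assumes d: "dec_ok (n + m) d" and n: "1 \<le> n"
  obtains d1 d2 where "dec_ok n d1" "dec_ok m d2" "join_dec m d1 d2 = d"
proof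
  \<comment> \<open>The first witness reads \<open>d\<close> at label 1 and past the block of
    \<open>D\<close>, the second on that block, with the value 0 elsewhere as \<open>dec_ok\<close>
    demands.\<close>
  show "dec_ok n (\<lambda>j. if j \<le> 1 then d j else d (m + j))"
    using assms by (auto simp: dec_ok_def)
  show "dec_ok m (\<lambda>j. if j \<in> {1..m} then d (Suc j) else 0)"
    using assms by (auto simp: dec_ok_def)
  show "join_dec m (\<lambda>j. if j \<le> 1 then d j else d (m + j)) (\<lambda>j. if j \<in> {1..m} then d (Suc j) else 0) = d"
  proof
    fix j
    have "d 0 = 0" using d by (simp add: dec_ok_def)
    then show "join_dec m (\<lambda>j. if j \<le> 1 then d j else d (m + j)) (\<lambda>j. if j \<in> {1..m} then d (Suc j) else 0) j = d j"
      by (cases "j = 0") (auto simp: join_dec_def)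
  qed
qed

section \<open>The decorated bijection and the comparison of coefficients\<close>

type_synonym dec_diagram = "chord set \<times> (nat \<Rightarrow> nat)"

definition DD_base :: "nat \<Rightarrow> nat \<Rightarrow> dec_diagram set" where
  "DD_base k N = {(C, d) \<in> DD N. base C \<ge> k}"

lemma DD_baseD:
  assumes "(C, d) \<in> DD_base k N"
  shows "rooted_connected (card C) C" "dec_ok (card C) d" "(\<Sum>i\<in>{1..card C}. d i) = N" "k \<le> base C"
  using assms by (auto simp: DD_base_def DD_def)

lemma finite_DD_base: "finite (DD_base k N)"
  unfolding DD_base_def by (rule finite_subset[OF _ finite_DD]) auto

text \<open>Everything can be read off the insertion: \<open>K\<close> is its first component,
  \<open>C\<close> and \<open>D\<close> are the normalised parts, and the right end of the root
  gives \<open>k\<close>.\<close>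

lemma ins_chord_inject:
  assumes "insertion n m k C D" "insertion n' m' k' C' D'" "ins_chord C k D = ins_chord C' k' D'"
  shows "C = C'" "D = D'" "k = k'"
proof -
  interpret I: insertion n m k C D by (rule assms(1))
  interpret J: insertion n' m' k' C' D' by (rule assms(2))
  have K: "I.K = J.K" using I.first_comp_ins J.first_comp_ins assms(3) by simp
  show D: "D = D'" using I.norm_K(1) J.norm_K(1) K by simp
  show C: "C = C'" using I.norm_rest(1) J.norm_rest(1) K assms(3) by simp
  show "k = k'" using I.snd_root_ins J.snd_root_ins C assms(3) by simp
qed

definition dec_ins :: "(dec_diagram \<times> dec_diagram) \<times> nat \<Rightarrow> dec_diagram" where
  "dec_ins = (\<lambda>(((C, d1), (D, d2)), i). (ins_chord C i D, join_dec (card D) d1 d2))"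

text \<open>\<open>M\<close> is the total decoration of the first diagram; keeping it in the tuple
  prepares the Cauchy product.\<close>

definition dec_pairs :: "nat \<Rightarrow> nat \<Rightarrow> (nat \<times> (dec_diagram \<times> dec_diagram) \<times> nat) set" where
  "dec_pairs k N = (SIGMA M:{0..N}. SIGMA p:DD_base 1 M \<times> DD_base k (N - M). {1..2 * card (fst (snd p)) - 1})"

text \<open>Existence and uniqueness of the root share decomposition, with additive decorations. The
  base label rises by one, so the bound \<open>Suc k\<close> on the insertion is the bound
  \<open>k\<close> on its inner part.\<close>

lemma bij_betw_dec_ins:
  assumes "1 \<le> k"
  shows "bij_betw (\<lambda>(M, z). dec_ins z) (dec_pairs k N) (DD_base (Suc k) N)"
  unfolding bij_betw_def
proof
  have ins: "insertion (card C) (card D) i C D"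
    if "(C, d1) \<in> DD_base 1 M" "(D, d2) \<in> DD_base k J" "i \<in> {1..2 * card D - 1}" for C D d1 d2 M J i
    using DD_baseD(1)[OF that(1)] DD_baseD(1)[OF that(2)] that(3) by unfold_locales auto
  show "inj_on (\<lambda>(M, z). dec_ins z) (dec_pairs k N)"
  proof (rule inj_onI)
    fix x y assume x: "x \<in> dec_pairs k N" and y: "y \<in> dec_pairs k N"
      and eq: "(case x of (M, z) \<Rightarrow> dec_ins z) = (case y of (M, z) \<Rightarrow> dec_ins z)"
    obtain M C d1 D d2 i where x': "x = (M, ((C, d1), (D, d2)), i)" by (metis surj_pair)
    obtain M' C' d1' D' d2' i' where y': "y = (M', ((C', d1'), (D', d2')), i')" by (metis surj_pair)
    have X: "(C, d1) \<in> DD_base 1 M" "(D, d2) \<in> DD_base k (N - M)" "i \<in> {1..2 * card D - 1}"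
      using x by (simp_all add: x' dec_pairs_def)
    have Y: "(C', d1') \<in> DD_base 1 M'" "(D', d2') \<in> DD_base k (N - M')" "i' \<in> {1..2 * card D' - 1}"
      using y by (simp_all add: y' dec_pairs_def)
    have E: "ins_chord C i D = ins_chord C' i' D'" and J: "join_dec (card D) d1 d2 = join_dec (card D') d1' d2'"
      using eq by (simp_all add: x' y' dec_ins_def)
    note same = ins_chord_inject[OF ins[OF X] ins[OF Y] E]
    have "d1 = d1'" "d2 = d2'"
      using join_dec_inject[OF DD_baseD(2)[OF X(1)] DD_baseD(2)[OF X(2)]] DD_baseD(2)[OF Y(1)] DD_baseD(2)[OF Y(2)] J
      by (simp_all add: same)
    moreover have "M = M'"
      using DD_baseD(3)[OF X(1)] DD_baseD(3)[OF Y(1)] \<open>d1 = d1'\<close> same by simp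
    ultimately show "x = y" using same by (simp add: x' y')
  qed
  show "(\<lambda>(M, z). dec_ins z) ` dec_pairs k N = DD_base (Suc k) N"
  proof
    show "(\<lambda>(M, z). dec_ins z) ` dec_pairs k N \<subseteq> DD_base (Suc k) N"
    proof
      fix w assume "w \<in> (\<lambda>(M, z). dec_ins z) ` dec_pairs k N"
      then obtain x where x: "x \<in> dec_pairs k N" "w = (case x of (M, z) \<Rightarrow> dec_ins z)" by blast
      obtain M C d1 D d2 i where x': "x = (M, ((C, d1), (D, d2)), i)" by (metis surj_pair)
      have X: "M \<le> N" "(C, d1) \<in> DD_base 1 M" "(D, d2) \<in> DD_base k (N - M)" "i \<in> {1..2 * card D - 1}"
        using x(1) by (simp_all add: x' dec_pairs_def)
      interpret insertion "card C" "card D" i C D by (rule ins[OF X(2-4)])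
      note C = DD_baseD[OF X(2)] and D = DD_baseD[OF X(3)]
      have "dec_ok (card E) (join_dec (card D) d1 d2)"
        unfolding card_ins using dec_ok_join[OF C(2) D(2) C_facts(1)] .
      moreover have "(\<Sum>j\<in>{1..card E}. join_dec (card D) d1 d2 j) = N"
        unfolding card_ins sum_join_dec[OF C_facts(1)] using C(3) D(3) X(1) by simp
      moreover have "Suc k \<le> base E" using base_ins D(4) by simp
      ultimately show "w \<in> DD_base (Suc k) N"
        using rooted_connected_ins card_ins by (simp add: x(2) x' dec_ins_def DD_base_def DD_def)
    qed
    show "DD_base (Suc k) N \<subseteq> (\<lambda>(M, z). dec_ins z) ` dec_pairs k N"
    proof
      fix w assume w: "w \<in> DD_base (Suc k) N"
      obtain X d where Xd: "w = (X, d)" by (cases w)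
      note X = DD_baseD[OF w[unfolded Xd]]
      \<comment> \<open>The base label is at least 2 and at most the number of chords, so the
        diagram decomposes.\<close>
      have "2 \<le> card X" using X(4) base_in[OF X(1)] assms by simp
      then obtain n m i C D where I: "insertion n m i C D" "X = ins_chord C i D"
        using rooted_connected_decomp[OF X(1)] by blast
      interpret insertion n m i C D by (rule I(1))
      have card: "card X = n + m" using card_ins I(2) by simp
      obtain d1 d2 where d: "dec_ok n d1" "dec_ok m d2" "join_dec m d1 d2 = d"
        using join_dec_surj[OF X(2)[unfolded card] C_facts(1)] .
      define M where "M = (\<Sum>j\<in>{1..n}. d1 j)"
      have N: "N = M + (\<Sum>j\<in>{1..m}. d2 j)"
        using X(3) sum_join_dec[OF C_facts(1), of m d1 d2] unfolding card d(3) M_def by simp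
      have "1 \<le> base C" using base_in[OF C] by simp
      moreover have "k \<le> base D" using X(4) I(2) base_ins by simp
      ultimately have "(C, d1) \<in> DD_base 1 M" "(D, d2) \<in> DD_base k (N - M)"
        using C D C_facts(3) D_facts(3) d N by (simp_all add: DD_base_def DD_def M_def)
      then have "(M, ((C, d1), (D, d2)), i) \<in> dec_pairs k N"
        using k N D_facts(3) by (simp add: dec_pairs_def)
      moreover have "dec_ins (((C, d1), (D, d2)), i) = w"
        using I(2) D_facts(3) d(3) by (simp add: dec_ins_def Xd)
      ultimately show "w \<in> (\<lambda>(M, z). dec_ins z) ` dec_pairs k N" by force
    qed
  qed
qed

definition dec_weight :: "int \<Rightarrow> (nat \<Rightarrow> nat \<Rightarrow> 'a::comm_ring_1) \<Rightarrow> nat \<Rightarrow> dec_diagram \<Rightarrow> 'a" where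
  "dec_weight s a k = (\<lambda>(C, d). omega s C d * hat_a a C d * a (d (base C)) (base C - k))"

lemma gcomb_nth: "fps_nth (gcomb s a k) N = (\<Sum>p\<in>DD_base k N. dec_weight s a k p)"
  by (simp add: gcomb_def DD_base_def dec_weight_def)

text \<open>The monomial is the same for all positions, so it leaves the sum and only
  \<open>omega\<close> is summed.\<close>

lemma sum_dec_weight_ins:
  fixes a :: "nat \<Rightarrow> nat \<Rightarrow> 'a::comm_ring_1"
  assumes qalg: "\<forall>n::nat. n > 0 \<longrightarrow> (\<exists>u::'a. of_nat n * u = 1)"
    and p: "p \<in> DD_base 1 M" and q: "q \<in> DD_base k J"
  shows "(\<Sum>i=1..2 * card (fst q) - 1. dec_weight s a (Suc k) (dec_ins ((p, q), i)))
      = dec_weight s a 1 p * ((of_int s * of_nat J - 1) * dec_weight s a k q)"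
proof -
  obtain C d1 where p': "p = (C, d1)" by (cases p)
  obtain D d2 where q': "q = (D, d2)" by (cases q)
  note C = DD_baseD[OF p[unfolded p']] and D = DD_baseD[OF q[unfolded q']]
  let ?c = "(hat_a a C d1 * a (d1 (base C)) (base C - 1)) * (hat_a a D d2 * a (d2 (base D)) (base D - k))"
  have "dec_weight s a (Suc k) (dec_ins ((p, q), i)) =
      omega s (ins_chord C i D) (join_dec (card D) d1 d2) * ?c" if "i \<in> {1..2 * card D - 1}" for i
  proof -
    interpret insertion "card C" "card D" i C D using C(1) D(1) that by unfold_locales auto
    show ?thesis using hat_a_ins[of a d1 d2 k] by (simp add: p' q' dec_ins_def dec_weight_def mult.assoc)
  qed
  then have "(\<Sum>i=1..2 * card (fst q) - 1. dec_weight s a (Suc k) (dec_ins ((p, q), i)))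
      = (\<Sum>i=1..2 * card D - 1. omega s (ins_chord C i D) (join_dec (card D) d1 d2)) * ?c"
    unfolding sum_distrib_right by (intro sum.cong) (simp_all add: q')
  also have "\<dots> = omega s C d1 * ((of_int s * of_nat J - 1) * omega s D d2) * ?c"
    unfolding sum_omega_ins[OF qalg C(1) D(1)] D(3) ..
  also have "\<dots> = dec_weight s a 1 p * ((of_int s * of_nat J - 1) * dec_weight s a k q)"
    by (simp only: p' q' dec_weight_def prod.case mult_ac)
  finally show ?thesis .
qed

lemma fps_euler_nth:
  fixes g :: "'a::comm_ring_1 fps"
  shows "fps_nth (fps_const c * fps_X * fps_deriv g - g) J = (c * of_nat J - 1) * fps_nth g J"
  by (cases J) (simp_all add: algebra_simps)

lemma sum_times_scaled_sum:
  fixes c :: "'a::comm_ring_1"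
  shows "sum f A * (c * sum g B) = (\<Sum>p\<in>A \<times> B. f (fst p) * (c * g (snd p)))"
  unfolding sum_distrib_left[of c] sum_product sum.cartesian_product by (simp add: case_prod_unfold)

theorem mainTheorem3:
  fixes a :: "nat \<Rightarrow> nat \<Rightarrow> 'a::comm_ring_1" and s :: int and k :: nat
  assumes qalg: "\<forall>n::nat. n > 0 \<longrightarrow> (\<exists>u::'a. of_nat n * u = 1)"
    and k: "k \<ge> 2"
  shows "gcomb s a k = gcomb s a 1 *
           (fps_const (of_int s) * fps_X * fps_deriv (gcomb s a (k - 1)) - gcomb s a (k - 1))"
proof (rule fps_ext)
  fix N
  define j where "j = k - 1"
  have j: "k = Suc j" "1 \<le> j" using k by (auto simp: j_def)
  have "fps_nth (gcomb s a k) N = (\<Sum>x\<in>dec_pairs j N. dec_weight s a k (case x of (M, z) \<Rightarrow> dec_ins z))"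
    unfolding gcomb_nth j(1) by (rule sum.reindex_bij_betw[symmetric, OF bij_betw_dec_ins[OF j(2)]])
  also have "\<dots> = (\<Sum>M=0..N. \<Sum>p\<in>DD_base 1 M \<times> DD_base j (N - M).
      \<Sum>i=1..2 * card (fst (snd p)) - 1. dec_weight s a k (dec_ins (p, i)))"
    unfolding dec_pairs_def
    by (simp add: sum.Sigma finite_DD_base case_prod_unfold)
  also have "\<dots> = (\<Sum>M=0..N. \<Sum>p\<in>DD_base 1 M \<times> DD_base j (N - M).
      dec_weight s a 1 (fst p) * ((of_int s * of_nat (N - M) - 1) * dec_weight s a j (snd p)))"
    unfolding j(1) using sum_dec_weight_ins[OF qalg] by (intro sum.cong refl) fastforce
  \<comment> \<open>Each inner sum factors; what remains is a Cauchy product whose second factor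
    carries the eigenvalue \<open>s * (N - M) - 1\<close> of the Euler operator.\<close>
  also have "\<dots> = (\<Sum>M=0..N. fps_nth (gcomb s a 1) M * ((of_int s * of_nat (N - M) - 1) * fps_nth (gcomb s a j) (N - M)))"
    unfolding gcomb_nth sum_times_scaled_sum ..
  finally show "fps_nth (gcomb s a k) N = fps_nth (gcomb s a 1 *
           (fps_const (of_int s) * fps_X * fps_deriv (gcomb s a (k - 1)) - gcomb s a (k - 1))) N"
    unfolding fps_mult_nth fps_euler_nth j_def .
qed

end
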